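(* Let $A$ be a unital $C^*$-algebra, let $\mathcal{H}$ be a finitely or countably generated Hilbert $A$-module, and let $C\in GL(\mathcal{H})$ be adjointable. Assume that $\{\psi_j : j\in J\}\subseteq\mathcal{H}$ is a $C$-controlled frame for $\mathcal{H}$ with bounds $m,M>0$. Then the $C$-controlled frame operator $S_C f=\sum_{j\in J}\langle f,\psi_j\rangle C\psi_j$ is invertible, positive, adjointable and self-adjoint.
   Context: Hilbert $A$-modules are left modules, with $A$-valued inner product $\langle\cdot,\cdot\rangle$ that is $A$-linear in the first variable, and norm $\|f\|=\|\langle f,f\rangle\|^{1/2}$. $J$ is a finite or countable index set. $GL(\mathcal{H})$ is the set of bounded linear operators on $\mathcal{H}$ with a bounded inverse. Given $C\in GL(\mathcal{H})$, a family $\{\psi_j\}_{j\in J}\subseteq\mathcal{H}$ is a $C$-controlled frame with bounds $m>0$ and $M<\infty$ if $$m\langle f,f\rangle\le\sum_{j\in J}\langle f,\psi_j\rangle\langle C\psi_j,f\rangle\le M\langle f,f\rangle\quad\text{for all } f\in\mathcal{H},$$ where the sum converges in norm and the inequalities are in the order of $A$. It is a $C$-controlled Bessel sequence if the upper inequality holds. For a $C$-controlled Bessel sequence, the operator $S_Cf=\sum_{j\in J}\langle f,\psi_j\rangle C\psi_j$ (which is well defined on $\mathcal{H}$) is called the $C$-controlled frame operator. *)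

theory Defs
  imports "HOL-Analysis.Analysis"
begin

text \<open>The complex scalar multiplication is declared separately from the norm, so that
  C*-algebras and Hilbert modules share one constant for it.\<close>

class complex_banach = banach +
  fixes scaleC :: "complex \<Rightarrow> 'a \<Rightarrow> 'a" (infixr "*\<^sub>C" 75)
  assumes scaleC_add_right: "c *\<^sub>C (x + y) = c *\<^sub>C x + c *\<^sub>C y"
    and scaleC_add_left: "(c + d) *\<^sub>C x = c *\<^sub>C x + d *\<^sub>C x"
    and scaleC_scaleC: "c *\<^sub>C d *\<^sub>C x = (c * d) *\<^sub>C x"
    and scaleC_of_real: "complex_of_real r *\<^sub>C x = r *\<^sub>R x"
    and norm_scaleC: "norm (c *\<^sub>C x) = cmod c * norm x"

text \<open>The unit is taken from \<^class>\<open>monoid_mult\<close> and not from \<^class>\<open>real_normed_algebra_1\<close>,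
  so that the zero algebra is not excluded; for a nonzero algebra \<open>norm 1 = 1\<close> follows from the
  C*-identity.\<close>

class unital_cstar_algebra = complex_banach + real_normed_algebra + monoid_mult +
  fixes star :: "'a \<Rightarrow> 'a"
  assumes mult_scaleC_left: "(c *\<^sub>C x) * y = c *\<^sub>C (x * y)"
    and mult_scaleC_right: "x * (c *\<^sub>C y) = c *\<^sub>C (x * y)"
    and star_star: "star (star x) = x"
    and star_add: "star (x + y) = star x + star y"
    and star_scaleC: "star (c *\<^sub>C x) = cnj c *\<^sub>C star x"
    and star_mult: "star (x * y) = star y * star x"
    and cstar_identity: "norm (star x * x) = (norm x)\<^sup>2"

definition spectrum :: "'a::unital_cstar_algebra \<Rightarrow> complex set" where
  "spectrum a = {z. \<not> (\<exists>b. (z *\<^sub>C 1 - a) * b = 1 \<and> b * (z *\<^sub>C 1 - a) = 1)}"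

definition cstar_positive :: "'a::unital_cstar_algebra \<Rightarrow> bool" where
  "cstar_positive a \<longleftrightarrow> star a = a \<and> spectrum a \<subseteq> complex_of_real ` {0..}"

definition cstar_le :: "'a::unital_cstar_algebra \<Rightarrow> 'a \<Rightarrow> bool" (infix "\<le>\<^sub>A" 50) where
  "a \<le>\<^sub>A b \<longleftrightarrow> cstar_positive (b - a)"

text \<open>The norm of \<open>'h\<close> is required to be the one induced by the inner product, and its
  completeness is part of \<^class>\<open>complex_banach\<close>.\<close>

locale hilbert_module =
  fixes act :: "'a::unital_cstar_algebra \<Rightarrow> 'h::complex_banach \<Rightarrow> 'h" (infixr "\<cdot>" 75)
    and ip :: "'h \<Rightarrow> 'h \<Rightarrow> 'a"
  assumes act_add_right: "a \<cdot> (f + g) = a \<cdot> f + a \<cdot> g"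
    and act_add_left: "(a + b) \<cdot> f = a \<cdot> f + b \<cdot> f"
    and act_act: "a \<cdot> b \<cdot> f = (a * b) \<cdot> f"
    and act_one: "1 \<cdot> f = f"
    and act_scaleC: "(c *\<^sub>C a) \<cdot> f = c *\<^sub>C (a \<cdot> f)"
    and ip_add_left: "ip (f + g) h = ip f h + ip g h"
    and ip_act_left: "ip (a \<cdot> f) g = a * ip f g"
    and ip_star: "star (ip f g) = ip g f"
    and ip_positive: "cstar_positive (ip f f)"
    and ip_definite: "ip f f = 0 \<Longrightarrow> f = 0"
    and norm_ip: "norm f = sqrt (norm (ip f f))"

definition module_span :: "('a::unital_cstar_algebra \<Rightarrow> 'h::complex_banach \<Rightarrow> 'h) \<Rightarrow> 'h set \<Rightarrow> 'h set"
  where "module_span act G = {\<Sum>g\<in>F. act (a g) g | F a. finite F \<and> F \<subseteq> G}"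

definition finitely_generated :: "('a::unital_cstar_algebra \<Rightarrow> 'h::complex_banach \<Rightarrow> 'h) \<Rightarrow> bool"
  where "finitely_generated act \<longleftrightarrow> (\<exists>G. finite G \<and> module_span act G = UNIV)"

text \<open>Countable generation is topological, finite generation is algebraic.\<close>

definition countably_generated :: "('a::unital_cstar_algebra \<Rightarrow> 'h::complex_banach \<Rightarrow> 'h) \<Rightarrow> bool"
  where "countably_generated act \<longleftrightarrow> (\<exists>G. countable G \<and> closure (module_span act G) = UNIV)"

definition bounded_clinear :: "('h::complex_banach \<Rightarrow> 'h) \<Rightarrow> bool" where
  "bounded_clinear T \<longleftrightarrow> bounded_linear T \<and> (\<forall>c f. T (c *\<^sub>C f) = c *\<^sub>C T f)"

definition GL :: "('h::complex_banach \<Rightarrow> 'h) set" where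
  "GL = {T. bounded_clinear T \<and> (\<exists>R. bounded_clinear R \<and> R \<circ> T = id \<and> T \<circ> R = id)}"

definition is_adjoint :: "('h \<Rightarrow> 'h \<Rightarrow> 'a) \<Rightarrow> ('h \<Rightarrow> 'h) \<Rightarrow> ('h \<Rightarrow> 'h) \<Rightarrow> bool" where
  "is_adjoint ip T R \<longleftrightarrow> (\<forall>f g. ip (T f) g = ip f (R g))"

definition adjointable :: "('h \<Rightarrow> 'h \<Rightarrow> 'a) \<Rightarrow> ('h \<Rightarrow> 'h) \<Rightarrow> bool" where
  "adjointable ip T \<longleftrightarrow> (\<exists>R. is_adjoint ip T R)"

definition selfadjoint :: "('h \<Rightarrow> 'h \<Rightarrow> 'a) \<Rightarrow> ('h \<Rightarrow> 'h) \<Rightarrow> bool" where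
  "selfadjoint ip T \<longleftrightarrow> is_adjoint ip T T"

definition positive_operator ::
    "('h \<Rightarrow> 'h \<Rightarrow> 'a::unital_cstar_algebra) \<Rightarrow> ('h \<Rightarrow> 'h) \<Rightarrow> bool" where
  "positive_operator ip T \<longleftrightarrow> (\<forall>f. 0 \<le>\<^sub>A ip (T f) f)"

text \<open>Sums over the unordered index set \<open>J\<close> are norm limits along the finite subsets of \<open>J\<close>.\<close>

definition controlled_bessel ::
    "('h \<Rightarrow> 'h \<Rightarrow> 'a::unital_cstar_algebra) \<Rightarrow> ('h \<Rightarrow> 'h) \<Rightarrow> ('j \<Rightarrow> 'h) \<Rightarrow> 'j set \<Rightarrow> real \<Rightarrow> bool" where
  "controlled_bessel ip C \<psi> J M \<longleftrightarrow>
     (\<forall>f. (\<lambda>j. ip f (\<psi> j) * ip (C (\<psi> j)) f) summable_on J \<and>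
          (\<Sum>\<^sub>\<infinity>j\<in>J. ip f (\<psi> j) * ip (C (\<psi> j)) f) \<le>\<^sub>A M *\<^sub>R ip f f)"

definition controlled_frame ::
    "('h \<Rightarrow> 'h \<Rightarrow> 'a::unital_cstar_algebra) \<Rightarrow> ('h \<Rightarrow> 'h) \<Rightarrow> ('j \<Rightarrow> 'h) \<Rightarrow> 'j set \<Rightarrow> real \<Rightarrow> real \<Rightarrow> bool" where
  "controlled_frame ip C \<psi> J m M \<longleftrightarrow>
     0 < m \<and> controlled_bessel ip C \<psi> J M \<and>
     (\<forall>f. m *\<^sub>R ip f f \<le>\<^sub>A (\<Sum>\<^sub>\<infinity>j\<in>J. ip f (\<psi> j) * ip (C (\<psi> j)) f))"

definition controlled_frame_operator ::
    "('a \<Rightarrow> 'h \<Rightarrow> 'h) \<Rightarrow> ('h \<Rightarrow> 'h \<Rightarrow> 'a) \<Rightarrow> ('h \<Rightarrow> 'h) \<Rightarrow> ('j \<Rightarrow> 'h) \<Rightarrow> 'j set \<Rightarrow> 'h::complex_banach \<Rightarrow> 'h" where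
  "controlled_frame_operator act ip C \<psi> J f = (\<Sum>\<^sub>\<infinity>j\<in>J. act (ip f (\<psi> j)) (C (\<psi> j)))"

end

theory Submission imports Defs begin

text \<open>The point is the convergence of \<open>S\<^sub>C\<close>, because the terms \<open>\<langle>f,\<psi>\<^sub>j\<rangle>\<langle>C\<psi>\<^sub>j,f\<rangle>\<close> need not be
  positive. By polarization \<open>\<Sum>\<langle>f,\<psi>\<^sub>j\<rangle>\<langle>C\<psi>\<^sub>j,g\<rangle> = \<Sum>\<langle>f,\<psi>\<^sub>j\<rangle>\<langle>\<psi>\<^sub>j,C\<^sup>*g\<rangle>\<close> converges for all \<open>f\<close>, \<open>g\<close>
  and is bounded by a multiple of \<open>\<parallel>f\<parallel> \<parallel>g\<parallel>\<close>. Since \<open>C\<^sup>*C\<close> is coercive, \<open>C\<^sup>*\<close> is onto with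
  a bounded right inverse, so \<open>C\<^sup>*g = f\<close> can be solved: \<open>\<psi>\<close> is an ordinary Bessel sequence, and
  \<open>\<Sum>\<langle>f,\<psi>\<^sub>j\<rangle>\<psi>\<^sub>j\<close> converges in norm. Then \<open>\<langle>S\<^sub>C f,f\<rangle>\<close> is the given sum; it is positive,
  polarization gives self-adjointness, and the lower frame bound makes \<open>S\<^sub>C\<close> coercive, hence
  invertible.\<close>

subsection \<open>Unital C*-algebras\<close>

lemma scaleC_zero_right [simp]: "c *\<^sub>C (0::'a::complex_banach) = 0"
  using scaleC_add_right[of c 0 0] by simp

lemma scaleC_zero_left [simp]: "0 *\<^sub>C (x::'a::complex_banach) = 0"
  using scaleC_add_left[of 0 0 x] by simp

lemma scaleC_one [simp]: "1 *\<^sub>C (x::'a::complex_banach) = x"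
  using scaleC_of_real[of 1 x] by simp

lemma scaleC_minus_right: "c *\<^sub>C (- x) = - (c *\<^sub>C (x::'a::complex_banach))"
  using scaleC_add_right[of c x "- x"] by (simp add: eq_neg_iff_add_eq_0 add.commute)

lemma scaleC_minus_left: "(- c) *\<^sub>C x = - (c *\<^sub>C (x::'a::complex_banach))"
  using scaleC_add_left[of c "- c" x] by (simp add: eq_neg_iff_add_eq_0 add.commute)

lemma scaleC_diff_right: "c *\<^sub>C (x - y) = c *\<^sub>C x - c *\<^sub>C (y::'a::complex_banach)"
  using scaleC_add_right[of c x "- y"] by (simp add: scaleC_minus_right)

lemma scaleC_diff_left: "(c - d) *\<^sub>C x = c *\<^sub>C x - d *\<^sub>C (x::'a::complex_banach)"
  using scaleC_add_left[of c "- d" x] by (simp add: scaleC_minus_left)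

lemma scaleR_scaleC_commute: "r *\<^sub>R (c *\<^sub>C x) = c *\<^sub>C (r *\<^sub>R (x::'a::complex_banach))"
  by (simp add: scaleC_of_real[symmetric] scaleC_scaleC mult.commute)

lemma bounded_linear_scaleC: "bounded_linear (\<lambda>x::'a::complex_banach. c *\<^sub>C x)"
  by (rule bounded_linear_intro[where K = "cmod c"])
     (auto simp: scaleC_add_right scaleR_scaleC_commute norm_scaleC mult.commute)

lemma star_scaleR: "star (r *\<^sub>R (x::'a::unital_cstar_algebra)) = r *\<^sub>R star x"
  using star_scaleC[of "complex_of_real r" x] by (simp add: scaleC_of_real)

lemma star_zero [simp]: "star (0::'a::unital_cstar_algebra) = 0"
  using star_scaleR[of 0 "0::'a"] by simp

lemma star_minus: "star (- (x::'a::unital_cstar_algebra)) = - star x"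
  using star_scaleR[of "-1" x] by simp

lemma star_diff: "star (x - (y::'a::unital_cstar_algebra)) = star x - star y"
  using star_add[of x "- y"] by (simp add: star_minus)

lemma star_one [simp]: "star (1::'a::unital_cstar_algebra) = 1"
  by (metis mult_1_left mult_1_right star_mult star_star)

lemma norm_star [simp]: "norm (star (x::'a::unital_cstar_algebra)) = norm x"
proof -
  have le: "norm x \<le> norm (star x)" for x :: 'a
  proof (cases "x = 0")
    case False
    have "norm x * norm x \<le> norm (star x) * norm x"
      using norm_mult_ineq[of "star x" x] by (simp add: cstar_identity power2_eq_square)
    then show ?thesis using False by simp
  qed simp
  show ?thesis using le[of x] le[of "star x"] by (simp add: star_star)
qed

lemma bounded_linear_star: "bounded_linear (star :: 'a::unital_cstar_algebra \<Rightarrow> 'a)"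
  by (rule bounded_linear_intro[where K = 1]) (auto simp: star_add star_scaleR)

text \<open>The C*-identity makes \<open>norm 1\<close> idempotent, so it is 0 or 1; the value 0
  belongs to the zero algebra.\<close>

lemma norm_one_le: "norm (1::'a::unital_cstar_algebra) \<le> 1"
proof -
  have "norm (1::'a) * norm (1::'a) = norm (1::'a)"
    using cstar_identity[of "1::'a"] by (simp add: power2_eq_square)
  then show ?thesis by (metis less_eq_real_def mult_cancel_left2 zero_le_one)
qed

section \<open>Invertible elements\<close>

definition invertible_elem :: "'a::monoid_mult \<Rightarrow> bool" where
  "invertible_elem x \<longleftrightarrow> (\<exists>y. x * y = 1 \<and> y * x = 1)"

definition inverse_elem :: "'a::monoid_mult \<Rightarrow> 'a" where
  "inverse_elem x = (SOME y. x * y = 1 \<and> y * x = 1)"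

lemma inverse_elem:
  assumes "invertible_elem x"
  shows "x * inverse_elem x = 1" "inverse_elem x * x = 1"
proof -
  have "x * inverse_elem x = 1 \<and> inverse_elem x * x = 1"
    unfolding inverse_elem_def
    by (rule someI_ex) (use assms in \<open>simp add: invertible_elem_def\<close>)
  then show "x * inverse_elem x = 1" "inverse_elem x * x = 1" by auto
qed

lemma inverse_elem_unique:
  fixes x :: "'a::monoid_mult"
  assumes "x * y = 1" "z * x = 1"
  shows "y = z"
proof -
  have "y = z * x * y" using assms(2) by simp
  also have "\<dots> = z * (x * y)" by (rule mult.assoc)
  finally show ?thesis using assms(1) by simp
qed

lemma invertible_elemI: "x * y = 1 \<Longrightarrow> z * x = 1 \<Longrightarrow> invertible_elem x"
  unfolding invertible_elem_def using inverse_elem_unique[of x y z] by blast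

lemma inverse_elem_eqI: "x * y = 1 \<Longrightarrow> y * x = 1 \<Longrightarrow> inverse_elem x = y"
  by (rule inverse_elem_unique) (auto intro: inverse_elem(1) invertible_elemI)

lemma invertible_elem_mult:
  assumes "invertible_elem x" "invertible_elem y"
  shows "invertible_elem (x * y)"
proof -
  obtain a b where ab: "x * a = 1" "a * x = 1" "y * b = 1" "b * y = 1"
    using assms unfolding invertible_elem_def by blast
  have "x * y * (b * a) = x * (y * b) * a" "b * a * (x * y) = b * (a * x) * y"
    by (simp_all only: mult.assoc)
  then show ?thesis
    unfolding invertible_elem_def by (intro exI[of _ "b * a"]) (simp add: ab)
qed

lemma invertible_elem_of_commuting_mult:
  assumes "x * y = y * x" "invertible_elem (x * y)"
  shows "invertible_elem x"
proof -
  obtain w where w: "x * y * w = 1" "w * (x * y) = 1"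
    using assms(2) unfolding invertible_elem_def by blast
  have "x * (y * w) = 1" using w(1) by (simp add: mult.assoc)
  moreover have "w * y * x = 1" using w(2) by (simp add: assms(1) mult.assoc)
  ultimately show ?thesis by (rule invertible_elemI)
qed

lemma commutes_inverse_elem:
  assumes "invertible_elem x" "x * y = y * x"
  shows "inverse_elem x * y = y * inverse_elem x"
proof -
  have "inverse_elem x * y = inverse_elem x * (y * x) * inverse_elem x"
    using inverse_elem[OF assms(1)] by (simp add: mult.assoc)
  also have "\<dots> = inverse_elem x * x * y * inverse_elem x"
    by (simp add: assms(2)[symmetric] mult.assoc)
  finally show ?thesis using inverse_elem[OF assms(1)] by simp
qed

section \<open>Spectrum and perturbation of invertible elements\<close>

lemma mem_spectrum_iff: "z \<in> spectrum a \<longleftrightarrow> \<not> invertible_elem (z *\<^sub>C 1 - a)"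
  by (simp add: spectrum_def invertible_elem_def)

lemma invertible_elem_scaleC:
  fixes a :: "'a::unital_cstar_algebra"
  assumes "c \<noteq> 0" "invertible_elem a"
  shows "invertible_elem (c *\<^sub>C a)"
proof -
  obtain y where "a * y = 1" "y * a = 1"
    using assms unfolding invertible_elem_def by blast
  then show ?thesis using assms(1)
    by (intro invertible_elemI[of _ "inverse c *\<^sub>C y" "inverse c *\<^sub>C y"])
       (simp_all add: mult_scaleC_left mult_scaleC_right scaleC_scaleC)
qed

text \<open>Instead of a Neumann series, Banach's fixed point theorem: \<open>1 + a * x\<close> and
  \<open>1 + x * a\<close> are contractions in \<open>x\<close>, and their fixed points are a right
  and a left inverse.\<close>

lemma invertible_elem_one_minus:
  fixes a :: "'a::unital_cstar_algebra"
  assumes "norm a < 1"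
  shows "invertible_elem (1 - a)"
proof -
  have "\<exists>!x. 1 + a * x = x"
  proof (rule banach_fix_type[where c = "norm a"])
    show "\<forall>x y. dist (1 + a * x) (1 + a * y) \<le> norm a * dist x y"
      using norm_mult_ineq by (auto simp: dist_norm right_diff_distrib[symmetric])
  qed (use assms in auto)
  then obtain b where "1 + a * b = b" by blast
  then have b: "(1 - a) * b = 1"
    by (metis add_diff_cancel_right' left_diff_distrib mult_1_left)
  have "\<exists>!x. 1 + x * a = x"
  proof (rule banach_fix_type[where c = "norm a"])
    show "\<forall>x y. dist (1 + x * a) (1 + y * a) \<le> norm a * dist x y"
      using norm_mult_ineq by (auto simp: dist_norm left_diff_distrib[symmetric] mult.commute[of "norm a"])
  qed (use assms in auto)
  then obtain c where "1 + c * a = c" by blast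
  then have c: "c * (1 - a) = 1"
    by (metis add_diff_cancel_right' right_diff_distrib mult_1_right)
  show ?thesis by (rule invertible_elemI[OF b c])
qed

text \<open>Resolvent identity: the inverses differ by
  \<open>inverse_elem x * (x - y) * inverse_elem y\<close>. Smallness lets half of
  \<open>norm (inverse_elem y)\<close> be absorbed; inserting the resulting bound gives the second
  estimate.\<close>

lemma norm_inverse_elem_le:
  fixes x y :: "'a::unital_cstar_algebra"
  assumes "invertible_elem x" "invertible_elem y"
    and "norm (x - y) * norm (inverse_elem x) \<le> 1 / 2"
  shows "norm (inverse_elem y) \<le> 2 * norm (inverse_elem x)"
    and "norm (inverse_elem y - inverse_elem x) \<le> 2 * (norm (inverse_elem x))\<^sup>2 * norm (x - y)"
proof -
  let ?X = "inverse_elem x" and ?Y = "inverse_elem y"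
  have eq: "?Y - ?X = ?X * (x - y) * ?Y"
  proof -
    have "?X * (x - y) * ?Y = ?X * x * ?Y - ?X * (y * ?Y)"
      by (simp add: right_diff_distrib left_diff_distrib mult.assoc)
    then show ?thesis using inverse_elem[OF assms(1)] inverse_elem[OF assms(2)] by simp
  qed
  have le: "norm (?Y - ?X) \<le> norm ?X * norm (x - y) * norm ?Y"
    unfolding eq by (meson mult_right_mono norm_ge_zero norm_mult_ineq order_trans)
  also have "\<dots> \<le> 1 / 2 * norm ?Y"
    using assms(3) by (intro mult_right_mono) (auto simp: mult.commute)
  finally have "norm ?Y \<le> norm ?X + norm ?Y / 2"
    using norm_triangle_sub[of ?Y ?X] by linarith
  then show Y: "norm ?Y \<le> 2 * norm ?X" by simp
  have "norm ?X * norm (x - y) * norm ?Y \<le> norm ?X * norm (x - y) * (2 * norm ?X)"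
    by (intro mult_left_mono Y) auto
  with le show "norm (?Y - ?X) \<le> 2 * (norm ?X)\<^sup>2 * norm (x - y)"
    by (simp add: power2_eq_square algebra_simps)
qed

lemma cmod_le_norm_of_mem_spectrum:
  assumes "z \<in> spectrum a"
  shows "cmod z \<le> norm a"
proof (rule ccontr)
  assume "\<not> ?thesis"
  then have lt: "norm a < cmod z" by simp
  then have z: "z \<noteq> 0" by auto
  have "norm (inverse z *\<^sub>C a) < 1"
    using lt z by (simp add: norm_scaleC norm_inverse inverse_eq_divide[symmetric] mult.commute[of _ "norm a"] divide_inverse[symmetric])
  then have "invertible_elem (z *\<^sub>C (1 - inverse z *\<^sub>C a))"
    using z invertible_elem_one_minus invertible_elem_scaleC by blast
  then show False
    using assms z by (simp add: mem_spectrum_iff scaleC_diff_right scaleC_scaleC)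
qed

lemma mem_spectrum_shift: "z + w \<in> spectrum (a + w *\<^sub>C 1) \<longleftrightarrow> z \<in> spectrum a"
  by (simp add: mem_spectrum_iff scaleC_add_left algebra_simps)

lemma mem_spectrum_minus: "- z \<in> spectrum (- a) \<longleftrightarrow> z \<in> spectrum a"
proof -
  have "invertible_elem (- x) \<longleftrightarrow> invertible_elem x" for x :: 'a
    using invertible_elem_scaleC[of "-1" x] invertible_elem_scaleC[of "-1" "- x"]
    by (auto simp: scaleC_minus_left)
  from this[of "z *\<^sub>C 1 - a"] show ?thesis
    by (simp add: mem_spectrum_iff scaleC_minus_left)
qed

lemma mem_spectrum_scaleR:
  assumes "r \<noteq> 0" "z \<in> spectrum (r *\<^sub>R a)"
  shows "z / of_real r \<in> spectrum a"
proof (rule ccontr)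
  assume "\<not> ?thesis"
  then have "invertible_elem (of_real r *\<^sub>C ((z / of_real r) *\<^sub>C 1 - a))"
    using assms(1) by (intro invertible_elem_scaleC) (auto simp: mem_spectrum_iff)
  then show False using assms
    by (simp add: mem_spectrum_iff scaleC_diff_right scaleC_scaleC scaleC_of_real)
qed

text \<open>Arens' trick: shifting \<open>a\<close> by \<open>\<i>r\<close> moves the spectrum linearly in \<open>r\<close>, whereas the
  C*-identity makes the square of the norm grow only like \<open>r\<^sup>2\<close>.\<close>

lemma spectrum_selfadjoint_real:
  fixes a :: "'a::unital_cstar_algebra"
  assumes "star a = a" "z \<in> spectrum a"
  shows "Im z = 0"
proof (rule ccontr)
  assume t: "Im z \<noteq> 0"
  \<comment> \<open>This \<open>r\<close> makes the cross term \<open>2 * Im z * r\<close> equal to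
    \<open>(norm a)\<^sup>2 + 1\<close>, more than the norm estimate allows.\<close>
  define r where "r = ((norm a)\<^sup>2 + 1) / (2 * Im z)"
  let ?w = "\<i> * of_real r"
  let ?x = "a + ?w *\<^sub>C 1"
  have "?w * ?w = - (of_real r * of_real r)" by (simp add: mult_ac)
  then have "star ?x * ?x = a * a + r\<^sup>2 *\<^sub>R 1"
    using assms(1)
    by (simp add: star_add star_scaleC distrib_left distrib_right mult_scaleC_left mult_scaleC_right
        scaleC_scaleC scaleC_add_right scaleC_minus_left scaleC_diff_right left_diff_distrib
        right_diff_distrib scaleC_of_real[symmetric] power2_eq_square)
  then have "(norm ?x)\<^sup>2 \<le> norm (a * a) + norm (r\<^sup>2 *\<^sub>R (1::'a))"
    using cstar_identity[of ?x] norm_triangle_ineq[of "a * a" "r\<^sup>2 *\<^sub>R 1"] by simp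
  also have "\<dots> \<le> (norm a)\<^sup>2 + r\<^sup>2"
    using norm_mult_ineq[of a a] mult_left_mono[OF norm_one_le[where 'a = 'a], of "r\<^sup>2"]
    by (simp add: power2_eq_square)
  finally have "(norm ?x)\<^sup>2 \<le> (norm a)\<^sup>2 + r\<^sup>2" .
  moreover have "cmod (z + ?w) \<le> norm ?x"
    using assms(2) mem_spectrum_shift cmod_le_norm_of_mem_spectrum by blast
  then have "(cmod (z + ?w))\<^sup>2 \<le> (norm ?x)\<^sup>2" by simp
  moreover have "(cmod (z + ?w))\<^sup>2 = (Re z)\<^sup>2 + (Im z)\<^sup>2 + 2 * Im z * r + r\<^sup>2"
    by (simp add: cmod_power2 power2_sum)
  moreover have "2 * Im z * r = (norm a)\<^sup>2 + 1"
    using t by (simp add: r_def)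
  ultimately show False
    using zero_le_power2[of "Re z"] zero_le_power2[of "Im z"] by linarith
qed

text \<open>Rickart's elementary argument for the spectral radius formula, along powers of two: if the
  disc of radius 1 avoids the inverted spectrum, the resolvent is uniformly continuous on it, and
  the bound survives each squaring because
  \<open>(1 - u\<^sup>2 b\<^sup>2)\<^sup>-\<^sup>1\<close> is the mean of \<open>(1 - u b)\<^sup>-\<^sup>1\<close> and \<open>(1 + u b)\<^sup>-\<^sup>1\<close>.\<close>

lemma resolvent_squaring:
  fixes b :: "'a::unital_cstar_algebra"
  assumes inv: "\<And>w. cmod w \<le> 1 \<Longrightarrow> invertible_elem (1 - w *\<^sub>C b)"
    and bd: "\<And>w. cmod w \<le> 1 \<Longrightarrow>
      norm (inverse_elem (1 - w *\<^sub>C b) - inverse_elem (1 - (of_real s * w) *\<^sub>C b)) \<le> e"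
    and s: "\<bar>s\<bar> \<le> 1" and w: "cmod w \<le> 1"
  shows "invertible_elem (1 - w *\<^sub>C (b * b))"
    and "norm (inverse_elem (1 - w *\<^sub>C (b * b)) - inverse_elem (1 - (of_real (s\<^sup>2) * w) *\<^sub>C (b * b))) \<le> e"
proof -
  have fact: "1 - u\<^sup>2 *\<^sub>C (b * b) = (1 - u *\<^sub>C b) * (1 - (- u) *\<^sub>C b)"
       "(1 - u *\<^sub>C b) * (1 - (- u) *\<^sub>C b) = (1 - (- u) *\<^sub>C b) * (1 - u *\<^sub>C b)" for u
    by (simp_all add: algebra_simps scaleC_minus_left scaleC_add_right scaleC_diff_right mult_scaleC_left mult_scaleC_right
        scaleC_scaleC power2_eq_square)
  have inv2: "invertible_elem (1 - u\<^sup>2 *\<^sub>C (b * b))" if "cmod u \<le> 1" for u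
    unfolding fact(1) using that by (intro invertible_elem_mult inv) auto
  have mean: "inverse_elem (1 - u\<^sup>2 *\<^sub>C (b * b))
      = (1/2) *\<^sub>R (inverse_elem (1 - u *\<^sub>C b) + inverse_elem (1 - (- u) *\<^sub>C b))"
    if "cmod u \<le> 1" for u
  proof -
    let ?p = "1 - u *\<^sub>C b" and ?q = "1 - (- u) *\<^sub>C b"
    let ?P = "inverse_elem ?p" and ?Q = "inverse_elem ?q"
    have ip: "invertible_elem ?p" and iq: "invertible_elem ?q" using that by (auto intro!: inv)
    \<comment> \<open>Multiplying \<open>?P + ?Q\<close> by \<open>?p * ?q\<close> from either side
      leaves \<open>?p + ?q\<close>, in which the terms with \<open>b\<close> cancel.\<close>
    have sum: "?p + ?q = 2 *\<^sub>R 1" by (simp add: scaleC_minus_left scaleR_2)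
    have cPq: "?P * ?q = ?q * ?P" by (rule commutes_inverse_elem[OF ip fact(2)])
    have "?p * ?q * (?P + ?Q) = ?p * (?P * ?q) + ?p * (?q * ?Q)"
      by (simp only: distrib_left mult.assoc cPq)
    also have "\<dots> = ?p * ?P * ?q + ?p * (?q * ?Q)" by (simp only: mult.assoc)
    also have "\<dots> = 2 *\<^sub>R 1"
      by (simp only: inverse_elem[OF ip] inverse_elem[OF iq] mult_1_left mult_1_right sum[symmetric] add.commute)
    finally have 1: "?p * ?q * (?P + ?Q) = 2 *\<^sub>R 1" .
    have "(?P + ?Q) * (?p * ?q) = ?P * ?p * ?q + ?Q * (?p * ?q)"
      by (simp only: distrib_right mult.assoc)
    also have "\<dots> = ?P * ?p * ?q + ?Q * ?q * ?p"
      by (simp only: fact(2) mult.assoc)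
    also have "\<dots> = 2 *\<^sub>R 1"
      by (simp only: inverse_elem[OF ip] inverse_elem[OF iq] mult_1_left mult_1_right sum[symmetric] add.commute)
    finally have 2: "(?P + ?Q) * (?p * ?q) = 2 *\<^sub>R 1" .
    show ?thesis
      unfolding fact(1)
      by (rule inverse_elem_eqI) (simp_all only: mult_scaleR_left mult_scaleR_right 1 2, simp_all)
  qed
  \<comment> \<open>The root of \<open>w\<close> stays in the disc, and scaling it by
    \<open>s\<close> scales \<open>w\<close> by \<open>s\<^sup>2\<close>. The difference for
    \<open>b * b\<close> is thus the mean of two differences for \<open>b\<close>, and the bound
    \<open>e\<close> does not grow.\<close>
  define u where "u = csqrt w"
  have u: "u\<^sup>2 = w" "cmod u \<le> 1" "cmod (- u) \<le> 1"
    using w by (simp_all add: u_def)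
  have su: "cmod (of_real s * u) \<le> 1"
    using u(2) s by (simp add: norm_mult mult_le_one)
  show "invertible_elem (1 - w *\<^sub>C (b * b))" using inv2[OF u(2)] u(1) by simp
  have sw: "of_real (s\<^sup>2) * w = (of_real s * u)\<^sup>2" using u(1) by (simp add: power_mult_distrib)
  let ?d = "\<lambda>u. inverse_elem (1 - u *\<^sub>C b) - inverse_elem (1 - (of_real s * u) *\<^sub>C b)"
  have "inverse_elem (1 - w *\<^sub>C (b * b)) - inverse_elem (1 - (of_real (s\<^sup>2) * w) *\<^sub>C (b * b))
      = (1/2) *\<^sub>R (?d u + ?d (- u))"
    unfolding sw mean[OF su] unfolding u(1)[symmetric] mean[OF u(2)]
    by (simp add: algebra_simps)
  also have "norm \<dots> \<le> (1/2) * (e + e)"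
    using norm_triangle_ineq[of "?d u" "?d (- u)"] bd[OF u(2)] bd[OF u(3)] by simp
  finally show "norm (inverse_elem (1 - w *\<^sub>C (b * b)) - inverse_elem (1 - (of_real (s\<^sup>2) * w) *\<^sub>C (b * b))) \<le> e"
    by simp
qed

subsection \<open>Spectral radius and positivity\<close>

lemma continuous_on_resolvent:
  fixes a :: "'a::unital_cstar_algebra"
  assumes inv: "\<And>w. w \<in> S \<Longrightarrow> invertible_elem (1 - w *\<^sub>C a)"
  shows "continuous_on S (\<lambda>w. inverse_elem (1 - w *\<^sub>C a))"
  unfolding continuous_on_iff
proof (intro ballI allI impI)
  fix x and e :: real assume x: "x \<in> S" and e: "0 < e"
  let ?X = "inverse_elem (1 - x *\<^sub>C a)"
  \<comment> \<open>\<open>K\<close> is positive and dominates both the Lipschitz constant from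
    \<open>norm_inverse_elem_le\<close> and twice the factor in its smallness condition.\<close>
  define K where "K = 2 * ((norm ?X + 1)\<^sup>2 * (norm a + 1))"
  have K: "K > 0" unfolding K_def
    by (intro mult_pos_pos zero_less_power add_nonneg_pos) auto
  have K1: "norm a * norm ?X \<le> K / 2"
    unfolding K_def by (simp add: power2_eq_square algebra_simps)
  have K2: "2 * (norm ?X)\<^sup>2 * norm a \<le> K"
    unfolding K_def by (simp add: power2_eq_square algebra_simps)
  show "\<exists>d>0. \<forall>y\<in>S. dist y x < d \<longrightarrow> dist (inverse_elem (1 - y *\<^sub>C a)) ?X < e"
  proof (intro exI[of _ "min 1 e / K"] conjI ballI impI)
    fix y assume y: "y \<in> S" and d: "dist y x < min 1 e / K"
    have "K * dist y x < min 1 e"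
      using d K by (simp add: field_simps)
    then have dK: "K * dist y x < 1" "K * dist y x < e" by auto
    have n: "norm ((1 - x *\<^sub>C a) - (1 - y *\<^sub>C a)) = dist y x * norm a"
      by (simp add: scaleC_diff_left[symmetric] norm_scaleC dist_norm)
    have "dist y x * (norm a * norm ?X) \<le> dist y x * (K / 2)"
      by (intro mult_left_mono K1) auto
    then have "norm ((1 - x *\<^sub>C a) - (1 - y *\<^sub>C a)) * norm ?X \<le> 1 / 2"
      unfolding n using dK(1) by (simp add: mult_ac)
    from norm_inverse_elem_le(2)[OF inv[OF x] inv[OF y] this]
    have "dist (inverse_elem (1 - y *\<^sub>C a)) ?X \<le> (2 * (norm ?X)\<^sup>2 * norm a) * dist y x"
      unfolding n dist_norm[of "inverse_elem _"] by (simp add: mult_ac)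
    also have "\<dots> \<le> K * dist y x"
      by (intro mult_right_mono K2) auto
    finally show "dist (inverse_elem (1 - y *\<^sub>C a)) ?X < e" using dK(2) by simp
  qed (use K e in auto)
qed

text \<open>Otherwise repeated squaring of \<open>a\<close> keeps the resolvent estimate on the
  closed disc, while the C*-identity keeps the norm at 1. After many squarings the resolvent at 1 is
  close to the unit, which forces the norm below 1.\<close>

lemma selfadjoint_norm_one_spectrum:
  fixes a :: "'a::unital_cstar_algebra"
  assumes a: "star a = a" "norm a = 1"
  shows "\<exists>w. cmod w \<le> 1 \<and> \<not> invertible_elem (1 - w *\<^sub>C a)"
proof (rule ccontr)
  assume "\<not> ?thesis"
  then have inv: "invertible_elem (1 - w *\<^sub>C a)" if "cmod w \<le> 1" for w
    using that by blast
  let ?f = "\<lambda>b w. inverse_elem (1 - w *\<^sub>C b)"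
  have "uniformly_continuous_on (cball 0 1) (?f a)"
    by (intro compact_uniformly_continuous continuous_on_resolvent inv) auto
  then obtain d where d: "d > 0" and
    dd: "\<And>x y. cmod x \<le> 1 \<Longrightarrow> cmod y \<le> 1 \<Longrightarrow> dist y x < d \<Longrightarrow> dist (?f a y) (?f a x) < 1 / 8"
    unfolding uniformly_continuous_on_def by (metis mem_cball_0 zero_less_divide_1_iff zero_less_numeral)
  \<comment> \<open>Then \<open>s < 1\<close>, while \<open>w\<close> and \<open>s * w\<close> are
    closer than \<open>d\<close> throughout the disc.\<close>
  define s where "s = 1 - min d 1 / 2"
  have s: "0 \<le> s" "s < 1" using d by (auto simp: s_def)
  have base: "norm (?f a w - ?f a (of_real s * w)) \<le> 1 / 8" if w: "cmod w \<le> 1" for w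
  proof -
    have "w - of_real s * w = of_real (min d 1 / 2) * w"
      by (simp add: s_def algebra_simps)
    then have "dist w (of_real s * w) = \<bar>min d 1 / 2\<bar> * cmod w"
      unfolding dist_norm by (simp only: norm_mult norm_of_real)
    also have "\<dots> = (min d 1 / 2) * cmod w" using d by simp
    also have "\<dots> \<le> (min d 1 / 2) * 1" using d w by (intro mult_left_mono) auto
    finally have "dist w (of_real s * w) < d" using d by simp
    moreover have "cmod (of_real s * w) \<le> 1" using s w by (simp add: norm_mult mult_le_one)
    ultimately show ?thesis using dd[OF _ w, of "of_real s * w"] w dd[of "of_real s * w" w]
      by (simp add: dist_norm less_imp_le)
  qed
  have "\<exists>b::'a. star b = b \<and> norm b = 1 \<and> (\<forall>w. cmod w \<le> 1 \<longrightarrow>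
      invertible_elem (1 - w *\<^sub>C b) \<and> norm (?f b w - ?f b (of_real (s ^ (2 ^ n)) * w)) \<le> 1 / 8)" for n
  proof (induction n)
    case 0
    then show ?case using a inv base by auto
  next
    case (Suc n)
    then obtain b :: 'a where b: "star b = b" "norm b = 1"
      "\<And>w. cmod w \<le> 1 \<Longrightarrow> invertible_elem (1 - w *\<^sub>C b)"
      "\<And>w. cmod w \<le> 1 \<Longrightarrow> norm (?f b w - ?f b (of_real (s ^ (2 ^ n)) * w)) \<le> 1 / 8"
      by blast
    have "\<bar>s ^ (2 ^ n)\<bar> \<le> 1" using s by (simp add: power_le_one)
    note sq = resolvent_squaring[OF b(3,4) this]
    have "(s ^ (2 ^ n))\<^sup>2 = s ^ (2 ^ Suc n)" by (simp add: power_mult[symmetric] mult.commute)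
    with sq have "invertible_elem (1 - w *\<^sub>C (b * b)) \<and>
        norm (?f (b * b) w - ?f (b * b) (of_real (s ^ (2 ^ Suc n)) * w)) \<le> 1 / 8"
      if "cmod w \<le> 1" for w using that by metis
    then show ?case
      using b(1,2) cstar_identity[of b] by (intro exI[of _ "b * b"]) (simp add: star_mult)
  qed
  moreover obtain n where "s ^ n < 1 / 16" using real_arch_pow_inv[of "1/16" s] s by auto
  then have t: "s ^ (2 ^ n) \<le> 1 / 16"
    using power_decreasing[of n "2 ^ n" s] s by (simp add: less_imp_le)
  ultimately obtain b :: 'a where b: "norm b = 1"
      "\<And>w. cmod w \<le> 1 \<Longrightarrow> invertible_elem (1 - w *\<^sub>C b)"
      "\<And>w. cmod w \<le> 1 \<Longrightarrow> norm (?f b w - ?f b (of_real (s ^ (2 ^ n)) * w)) \<le> 1 / 8"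
    by blast
  let ?t = "complex_of_real (s ^ (2 ^ n))"
  have ct: "cmod ?t = s ^ (2 ^ n)" using s by (simp only: norm_of_real) simp
  have one: "invertible_elem (1::'a)" "inverse_elem (1::'a) = 1"
    by (auto intro: invertible_elemI inverse_elem_eqI)
  have nt: "norm (1 - (1 - ?t *\<^sub>C b)) \<le> 1 / 16" using t b(1) ct by (simp add: norm_scaleC)
  \<comment> \<open>Comparison with the resolvent at the parameter 0, which is 1. It costs
    \<open>1 / 8\<close>, as does the passage from the parameter 1 to \<open>?t\<close>.\<close>
  have "norm (?f b ?t - 1) \<le> 2 * (norm (1::'a))\<^sup>2 * norm (1 - (1 - ?t *\<^sub>C b))"
  proof -
    have "norm (1 - (1 - ?t *\<^sub>C b)) * norm (1::'a) \<le> (1 / 16) * 1"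
      by (intro mult_mono nt norm_one_le) auto
    then have "norm (1 - (1 - ?t *\<^sub>C b)) * norm (inverse_elem (1::'a)) \<le> 1 / 2"
      by (simp add: one)
    from norm_inverse_elem_le(2)[OF one(1) b(2) this] show ?thesis
      using ct t by (simp add: one)
  qed
  also have "\<dots> \<le> 2 * 1 * (1 / 16)"
    by (intro mult_mono nt) (auto simp: power_le_one norm_one_le)
  finally have "norm (?f b 1 - 1) \<le> 1 / 4"
    using b(3)[of 1] norm_triangle_ineq[of "?f b 1 - ?f b ?t" "?f b ?t - 1"] by simp
  \<comment> \<open>This product has norm at most \<open>1 / 4 * 2\<close>, against
    \<open>norm b = 1\<close>.\<close>
  moreover have "b = (?f b 1 - 1) * (1 - b)"
    using inverse_elem(2)[OF b(2)[of 1]] by (simp add: left_diff_distrib)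
  then have "norm b \<le> norm (?f b 1 - 1) * norm (1 - b)"
    by (metis norm_mult_ineq)
  moreover have "norm (1 - b) \<le> 2"
    using norm_triangle_ineq4[of 1 b] norm_one_le[where 'a = 'a] b(1) by simp
  moreover have "norm (?f b 1 - 1) * norm (1 - b) \<le> (1 / 4) * 2"
    using calculation by (intro mult_mono) auto
  ultimately show False using b(1) by simp
qed

text \<open>The norm is at most the spectral radius: after scaling to norm 1, a parameter
  \<open>w\<close> in the unit disc with singular \<open>1 - w *\<^sub>C ?b\<close> yields the
  spectral point \<open>norm a / w\<close>, of modulus at least \<open>norm a\<close>.\<close>

lemma norm_le_of_spectrum:
  fixes a :: "'a::unital_cstar_algebra"
  assumes a: "star a = a" and r: "0 \<le> r" and sp: "\<And>z. z \<in> spectrum a \<Longrightarrow> cmod z \<le> r"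
  shows "norm a \<le> r"
proof (rule ccontr)
  assume "\<not> ?thesis"
  then have lt: "r < norm a" by simp
  then have N: "norm a > 0" using r by linarith
  let ?b = "inverse (norm a) *\<^sub>R a"
  have "a \<noteq> 0" using N by auto
  then have "star ?b = ?b" "norm ?b = 1" by (simp_all add: star_scaleR a)
  then obtain w where w: "cmod w \<le> 1" "\<not> invertible_elem (1 - w *\<^sub>C ?b)"
    using selfadjoint_norm_one_spectrum by blast
  have "w \<noteq> 0" using w(2) by (auto intro!: invertible_elemI)
  let ?z = "of_real (norm a) / w"
  have "norm a \<le> cmod ?z"
    using w(1) N \<open>w \<noteq> 0\<close> by (simp add: norm_divide divide_simps mult_left_le)
  then have "invertible_elem (?z *\<^sub>C 1 - a)"
    using sp[of ?z] lt by (auto simp: mem_spectrum_iff)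
  then have "invertible_elem ((w / of_real (norm a)) *\<^sub>C (?z *\<^sub>C 1 - a))"
    using \<open>w \<noteq> 0\<close> N by (intro invertible_elem_scaleC) auto
  moreover have "w / of_real (norm a) * ?z = 1" using \<open>w \<noteq> 0\<close> N by simp
  then have "(w / of_real (norm a)) *\<^sub>C (?z *\<^sub>C 1 - a) = 1 - w *\<^sub>C ?b"
    by (simp only: scaleC_diff_right scaleC_scaleC scaleC_one)
      (simp add: scaleC_scaleC scaleC_of_real[symmetric] divide_inverse)
  ultimately show False using w(2) by simp
qed

section \<open>The positive cone and its order\<close>

lemma cstar_positive_iff_Re:
  "cstar_positive a \<longleftrightarrow> star a = a \<and> (\<forall>z\<in>spectrum a. 0 \<le> Re z)"
proof -
  have "z \<in> complex_of_real ` {0..} \<longleftrightarrow> Im z = 0 \<and> 0 \<le> Re z" for z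
    by (auto simp: image_iff complex_eq_iff)
  then show ?thesis
    unfolding cstar_positive_def using spectrum_selfadjoint_real[of a] by blast
qed

lemma mem_spectrum_reflect: "z \<in> spectrum (t *\<^sub>R 1 - a) \<longleftrightarrow> of_real t - z \<in> spectrum a"
  using mem_spectrum_shift[of "z - of_real t" "of_real t" "- a"]
    mem_spectrum_minus[of "of_real t - z" a]
  by (simp add: scaleC_of_real)

lemma star_reflect: "star a = a \<Longrightarrow> star (t *\<^sub>R 1 - a) = t *\<^sub>R 1 - a"
  by (simp add: star_diff star_scaleR)

text \<open>Turns positivity into a norm inequality, which is stable under sums and limits. The
  spectrum of \<open>a\<close> lies in the interval from \<open>- t\<close> to \<open>t\<close>, and
  the reflected one stays within \<open>t\<close> of 0 exactly if no point of it is
  negative.\<close>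

lemma cstar_positive_iff_norm:
  fixes a :: "'a::unital_cstar_algebra"
  assumes a: "star a = a" and t: "norm a \<le> t"
  shows "cstar_positive a \<longleftrightarrow> norm (t *\<^sub>R 1 - a) \<le> t"
proof
  assume pos: "cstar_positive a"
  show "norm (t *\<^sub>R 1 - a) \<le> t"
  proof (rule norm_le_of_spectrum[OF star_reflect[OF a]])
    show "0 \<le> t" using t norm_ge_zero[of a] by linarith
    fix z assume "z \<in> spectrum (t *\<^sub>R 1 - a)"
    then have z: "of_real t - z \<in> spectrum a" by (simp add: mem_spectrum_reflect)
    have "Im (of_real t - z) = 0" by (rule spectrum_selfadjoint_real[OF a z])
    moreover have "0 \<le> Re (of_real t - z)" using pos z by (auto simp: cstar_positive_iff_Re)
    moreover have "cmod (of_real t - z) \<le> t" using cmod_le_norm_of_mem_spectrum[OF z] t by simp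
    ultimately show "cmod z \<le> t"
      using complex_Re_le_cmod[of "of_real t - z"] by (simp add: cmod_eq_Re)
  qed
next
  assume le: "norm (t *\<^sub>R 1 - a) \<le> t"
  show "cstar_positive a"
    unfolding cstar_positive_iff_Re
  proof (intro conjI ballI a)
    fix z assume "z \<in> spectrum a"
    then have "of_real t - z \<in> spectrum (t *\<^sub>R 1 - a)" by (simp add: mem_spectrum_reflect)
    then have "cmod (of_real t - z) \<le> t" using cmod_le_norm_of_mem_spectrum le by fastforce
    then show "0 \<le> Re z" using complex_Re_le_cmod[of "of_real t - z"] by simp
  qed
qed

lemma cstar_positive_selfadjoint: "cstar_positive a \<Longrightarrow> star a = a"
  by (simp add: cstar_positive_def)

lemma cstar_positive_zero [simp]: "cstar_positive 0"
  using cstar_positive_iff_norm[of 0 0] by simp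

lemma cstar_positive_add:
  fixes a b :: "'a::unital_cstar_algebra"
  assumes "cstar_positive a" "cstar_positive b"
  shows "cstar_positive (a + b)"
proof -
  have sa: "star a = a" "star b = b" using assms by (auto intro: cstar_positive_selfadjoint)
  have "(norm a + norm b) *\<^sub>R 1 - (a + b) = (norm a *\<^sub>R 1 - a) + (norm b *\<^sub>R 1 - b)"
    by (simp add: scaleR_add_left)
  then have "norm ((norm a + norm b) *\<^sub>R 1 - (a + b)) \<le> norm (norm a *\<^sub>R 1 - a) + norm (norm b *\<^sub>R 1 - b)"
    by (simp only: norm_triangle_ineq)
  also have "\<dots> \<le> norm a + norm b"
    using assms sa by (intro add_mono) (simp_all add: cstar_positive_iff_norm[symmetric])
  finally show ?thesis
    using sa by (subst cstar_positive_iff_norm[of _ "norm a + norm b"])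
      (auto simp: star_add norm_triangle_ineq)
qed

lemma cstar_positive_sum:
  assumes "\<And>j. j \<in> F \<Longrightarrow> cstar_positive (f j)"
  shows "cstar_positive (sum f F)"
  using assms by (induction F rule: infinite_finite_induct) (auto intro: cstar_positive_add)

lemma cstar_positive_scaleR:
  assumes "cstar_positive a" "0 \<le> r"
  shows "cstar_positive (r *\<^sub>R a)"
proof (cases "r = 0")
  case False
  have "0 \<le> Re z" if "z \<in> spectrum (r *\<^sub>R a)" for z
    using mem_spectrum_scaleR[OF False that] assms False
    by (auto simp: cstar_positive_iff_Re Re_divide_of_real zero_le_divide_iff)
  then show ?thesis using assms(1) by (auto simp: cstar_positive_iff_Re star_scaleR)
qed simp

text \<open>Both \<open>a\<close> and \<open>norm b *\<^sub>R 1 - a\<close> are positive, the latter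
  via \<open>b\<close>. Hence the spectrum of \<open>a\<close> lies between 0 and
  \<open>norm b\<close>, and it controls the norm.\<close>

lemma norm_mono_cstar_positive:
  fixes a b :: "'a::unital_cstar_algebra"
  assumes a: "cstar_positive a" and ba: "cstar_positive (b - a)"
  shows "norm a \<le> norm b"
proof -
  have b: "cstar_positive b" using cstar_positive_add[OF a ba] by simp
  have sb: "star b = b" and sa: "star a = a"
    using a b by (auto intro: cstar_positive_selfadjoint)
  have "cstar_positive (norm b *\<^sub>R 1 - b)"
    unfolding cstar_positive_iff_Re
  proof (intro conjI ballI star_reflect[OF sb])
    fix z assume "z \<in> spectrum (norm b *\<^sub>R 1 - b)"
    then have "cmod (of_real (norm b) - z) \<le> norm b"
      by (intro cmod_le_norm_of_mem_spectrum) (simp add: mem_spectrum_reflect)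
    then show "0 \<le> Re z" using complex_Re_le_cmod[of "of_real (norm b) - z"] by simp
  qed
  from cstar_positive_add[OF this ba] have pos: "cstar_positive (norm b *\<^sub>R 1 - a)" by simp
  show ?thesis
  proof (rule norm_le_of_spectrum[OF sa])
    fix z assume z: "z \<in> spectrum a"
    have "of_real (norm b) - z \<in> spectrum (norm b *\<^sub>R 1 - a)" using z by (simp add: mem_spectrum_reflect)
    then have "0 \<le> Re (of_real (norm b) - z)" using pos unfolding cstar_positive_iff_Re by blast
    moreover have "0 \<le> Re z" "Im z = 0"
      using a z spectrum_selfadjoint_real[OF sa z] by (auto simp: cstar_positive_iff_Re)
    ultimately show "cmod z \<le> norm b" by (simp add: cmod_eq_Re)
  qed simp
qed

text \<open>With \<open>t\<close> the norm of the element itself, positivity of a self-adjoint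
  element is an inequality between continuous functions.\<close>

lemma cstar_positive_tendsto:
  fixes f :: "'i \<Rightarrow> 'a::unital_cstar_algebra"
  assumes lim: "(f \<longlongrightarrow> a) F" and F: "F \<noteq> bot" and pos: "eventually (\<lambda>i. cstar_positive (f i)) F"
  shows "cstar_positive a"
proof -
  have sa: "star a = a"
  proof (rule tendsto_unique[OF F _ lim])
    have "((\<lambda>i. star (f i)) \<longlongrightarrow> star a) F" by (rule bounded_linear.tendsto[OF bounded_linear_star lim])
    then show "(f \<longlongrightarrow> star a) F"
      by (rule Lim_transform_eventually) (use pos in \<open>auto elim!: eventually_mono intro: cstar_positive_selfadjoint\<close>)
  qed
  have "((\<lambda>i. norm (f i)) \<longlongrightarrow> norm a) F" by (intro tendsto_intros lim)
  moreover have "((\<lambda>i. norm (norm (f i) *\<^sub>R 1 - f i)) \<longlongrightarrow> norm (norm a *\<^sub>R 1 - a)) F"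
    by (intro tendsto_intros lim)
  moreover have "eventually (\<lambda>i. norm (norm (f i) *\<^sub>R 1 - f i) \<le> norm (f i)) F"
    using pos
  proof eventually_elim
    case (elim i)
    then show ?case using cstar_positive_iff_norm[OF cstar_positive_selfadjoint[OF elim] order.refl] by simp
  qed
  ultimately have "norm (norm a *\<^sub>R 1 - a) \<le> norm a"
    by (rule tendsto_le[OF F])
  then show ?thesis using cstar_positive_iff_norm[OF sa order.refl] by simp
qed

text \<open>With \<open>w\<close> a root of \<open>z\<close>, one factor of
  \<open>(w - a) (w + a)\<close> is singular; self-adjointness makes \<open>w\<close> real, so its
  square is nonnegative.\<close>

lemma cstar_positive_selfadjoint_square:
  fixes a :: "'a::unital_cstar_algebra"
  assumes a: "star a = a"
  shows "cstar_positive (a * a)"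
  unfolding cstar_positive_iff_Re
proof (intro conjI ballI)
  show "star (a * a) = a * a" by (simp add: star_mult a)
  fix z assume z: "z \<in> spectrum (a * a)"
  define w where "w = csqrt z"
  have zw: "z = w * w" by (simp add: w_def power2_eq_square[symmetric])
  have "z *\<^sub>C 1 - a * a = (w *\<^sub>C 1 - a) * (w *\<^sub>C 1 - (- a))"
    unfolding zw by (simp add: algebra_simps mult_scaleC_left mult_scaleC_right scaleC_scaleC scaleC_add_right scaleC_diff_right)
  then have "w \<in> spectrum a \<or> w \<in> spectrum (- a)"
    using z invertible_elem_mult by (metis mem_spectrum_iff)
  then have "Im w = 0"
    using spectrum_selfadjoint_real[of a w] spectrum_selfadjoint_real[of "- a" w] a by (auto simp: star_minus)
  then show "0 \<le> Re z" by (simp add: zw)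
qed

text \<open>If \<open>u\<close> inverts \<open>z - x y\<close>, then \<open>(1 + y u x) / z\<close>
  inverts \<open>z - y x\<close>; the division excludes \<open>z = 0\<close>.\<close>

lemma mem_spectrum_mult_commute:
  fixes x y :: "'a::unital_cstar_algebra"
  assumes z: "z \<noteq> 0" "z \<in> spectrum (y * x)"
  shows "z \<in> spectrum (x * y)"
proof (rule ccontr)
  assume "\<not> ?thesis"
  then have "invertible_elem (z *\<^sub>C 1 - x * y)" by (simp add: mem_spectrum_iff)
  then obtain u where u: "(z *\<^sub>C 1 - x * y) * u = 1" "u * (z *\<^sub>C 1 - x * y) = 1"
    unfolding invertible_elem_def by blast
  have u1: "x * y * u = z *\<^sub>C u - 1" and u2: "u * (x * y) = z *\<^sub>C u - 1"
    using u by (simp_all add: left_diff_distrib right_diff_distrib mult_scaleC_left mult_scaleC_right algebra_simps)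
  have "(z *\<^sub>C 1 - y * x) * (1 + y * u * x) = z *\<^sub>C 1 - y * x + z *\<^sub>C (y * u * x) - y * (x * y * u) * x"
    by (simp add: algebra_simps scaleC_add_right mult_scaleC_left)
  also have "\<dots> = z *\<^sub>C 1"
    unfolding u1 by (simp add: algebra_simps scaleC_add_right mult_scaleC_left mult_scaleC_right)
  finally have 1: "(z *\<^sub>C 1 - y * x) * (1 + y * u * x) = z *\<^sub>C 1" .
  have "(1 + y * u * x) * (z *\<^sub>C 1 - y * x) = z *\<^sub>C 1 - y * x + z *\<^sub>C (y * u * x) - y * (u * (x * y)) * x"
    by (simp add: algebra_simps scaleC_add_right mult_scaleC_right)
  also have "\<dots> = z *\<^sub>C 1"
    unfolding u2 by (simp add: algebra_simps scaleC_add_right mult_scaleC_left mult_scaleC_right)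
  finally have 2: "(1 + y * u * x) * (z *\<^sub>C 1 - y * x) = z *\<^sub>C 1" .
  have "invertible_elem (z *\<^sub>C 1 - y * x)"
    by (rule invertible_elemI[of _ "inverse z *\<^sub>C (1 + y * u * x)" "inverse z *\<^sub>C (1 + y * u * x)"])
       (use z(1) in \<open>simp_all only: mult_scaleC_left mult_scaleC_right 1 2 scaleC_scaleC\<close>, simp_all)
  then show False using z(2) by (simp add: mem_spectrum_iff)
qed

text \<open>Suppose \<open>b = x\<^sup>*x\<close> has \<open>-\<alpha> < 0\<close> in its spectrum, near the bottom. For
  \<open>y = x (b + 2\<alpha>)\<^sup>-\<^sup>1\<close> the spectrum of \<open>y\<^sup>*y\<close> is the image of that of \<open>b\<close>
  under \<open>t / (t + 2\<alpha>)\<^sup>2\<close>, which is at most \<open>\<epsilon> = 1 / (8\<alpha>)\<close> but takes the value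
  \<open>-1 / \<alpha>\<close>. The bound \<open>\<epsilon>\<close> passes to \<open>y y\<^sup>*\<close>, and since
  \<open>y\<^sup>*y + y y\<^sup>*\<close> is a sum of squares, \<open>y\<^sup>*y \<ge> -\<epsilon>\<close>: a contradiction.\<close>

lemma cstar_positive_star_mult_self:
  fixes x :: "'a::unital_cstar_algebra"
  shows "cstar_positive (star x * x)"
proof (rule ccontr)
  define b where "b = star x * x"
  have sb: "star b = b" by (simp add: b_def star_mult star_star)
  assume "\<not> cstar_positive (star x * x)"
  then obtain z0 where z0: "z0 \<in> spectrum b" "Re z0 < 0"
    using sb by (auto simp: cstar_positive_iff_Re b_def[symmetric] not_le)
  define s where "s = Inf (Re ` spectrum b)"
  have bdd: "bdd_below (Re ` spectrum b)"
  proof (rule bdd_belowI2)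
    fix z assume "z \<in> spectrum b"
    then show "- norm b \<le> Re z"
      using cmod_le_norm_of_mem_spectrum[of z b] abs_Re_le_cmod[of z] by linarith
  qed
  have s_le: "s \<le> Re z" if "z \<in> spectrum b" for z
    unfolding s_def using that bdd by (intro cInf_lower) auto
  \<comment> \<open>The infimum \<open>s\<close> is negative, so some spectral point lies below
    \<open>s / 2\<close>. Its negated real part \<alpha> satisfies
    \<open>- (2 * \<alpha>) < s\<close>, which makes \<open>B\<close> invertible.\<close>
  have "s < s / 2" using s_le[OF z0(1)] z0(2) by simp
  then obtain z where z: "z \<in> spectrum b" "Re z < s / 2"
    using cInf_lessD[of "Re ` spectrum b" "s / 2"] z0(1) unfolding s_def by auto
  define \<alpha> where "\<alpha> = - Re z"
  have \<alpha>: "\<alpha> > 0" "- (2 * \<alpha>) < s" using z s_le[OF z0(1)] z0(2) by (auto simp: \<alpha>_def)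
  have z_eq: "z = - of_real \<alpha>"
    using spectrum_selfadjoint_real[OF sb z(1)] by (simp add: \<alpha>_def complex_eq_iff)
  define B where "B = b + (2 * \<alpha>) *\<^sub>R 1"
  have sB: "star B = B" by (simp add: B_def star_add star_scaleR sb)
  have neg: "invertible_elem (u::'a)" if "invertible_elem (- u)" for u
    using invertible_elem_scaleC[of "-1" "- u"] that by (simp add: scaleC_minus_left)
  have invB: "invertible_elem B"
  proof (rule neg)
    have "- of_real (2 * \<alpha>) \<notin> spectrum b" using s_le \<alpha>(2) by fastforce
    moreover have "- B = - of_real (2 * \<alpha>) *\<^sub>C 1 - b"
      by (simp add: B_def eq_diff_eq scaleC_minus_left scaleC_of_real del: of_real_mult)
    ultimately show "invertible_elem (- B)" by (simp only: mem_spectrum_iff not_not)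
  qed
  define d where "d = inverse_elem B"
  have d: "B * d = 1" "d * B = 1" using inverse_elem[OF invB] by (auto simp: d_def)
  have invd: "invertible_elem d" using d by (auto intro: invertible_elemI)
  have sd: "star d = d"
  proof -
    have "star d * B = 1" using d(1) star_mult[of B d] by (simp add: sB)
    from inverse_elem_unique[OF d(1) this] show ?thesis by (rule sym)
  qed
  define y where "y = x * d"
  define \<epsilon> where "\<epsilon> = 1 / (8 * \<alpha>)"
  have \<epsilon>: "\<epsilon> > 0" using \<alpha>(1) by (simp add: \<epsilon>_def)
  have yy: "star y * y = d * b * d" by (simp add: y_def b_def star_mult sd mult.assoc)
  have syy: "star (star y * y) = star y * y" "star (y * star y) = y * star y"
    by (simp_all add: star_mult star_star)
  have "d * b * d = d * (B - (2 * \<alpha>) *\<^sub>R 1) * d" by (simp add: B_def)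
  also have "\<dots> = d - (2 * \<alpha>) *\<^sub>R (d * d)"
    by (simp add: left_diff_distrib right_diff_distrib d(2))
  finally have dbd: "d * b * d = d - (2 * \<alpha>) *\<^sub>R (d * d)" .
  \<comment> \<open>Completes the square in \<open>d - 2 \<alpha> d\<^sup>2\<close>, whose maximum
    \<epsilon> is attained at \<open>d = 1 / (4 \<alpha>)\<close>.\<close>
  define e where "e = d - (1 / (4 * \<alpha>)) *\<^sub>R 1"
  have "\<epsilon> *\<^sub>R 1 - star y * y = (2 * \<alpha>) *\<^sub>R (e * e)"
  proof -
    have "e * e = d * d - (1 / (2 * \<alpha>)) *\<^sub>R d + (1 / (16 * \<alpha>\<^sup>2)) *\<^sub>R 1"
      by (simp add: e_def algebra_simps power2_eq_square scaleR_add_left[symmetric])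
    then have "(2 * \<alpha>) *\<^sub>R (e * e) = (2 * \<alpha>) *\<^sub>R (d * d) - d + (1 / (8 * \<alpha>)) *\<^sub>R 1"
      using \<alpha>(1) by (simp add: scaleR_add_right scaleR_diff_right power2_eq_square)
    then show ?thesis by (simp add: yy dbd \<epsilon>_def)
  qed
  moreover have "cstar_positive ((2 * \<alpha>) *\<^sub>R (e * e))"
    using \<alpha>(1) by (intro cstar_positive_scaleR cstar_positive_selfadjoint_square)
      (auto simp: e_def star_diff star_scaleR sd)
  ultimately have upper: "cstar_positive (\<epsilon> *\<^sub>R 1 - star y * y)" by simp
  have "cstar_positive (\<epsilon> *\<^sub>R 1 - y * star y)"
    unfolding cstar_positive_iff_Re
  proof (intro conjI ballI star_reflect syy)
    fix w assume w: "w \<in> spectrum (\<epsilon> *\<^sub>R 1 - y * star y)"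
    show "0 \<le> Re w"
    proof (cases "of_real \<epsilon> - w = 0")
      case True
      then show ?thesis using \<epsilon> by (auto simp: complex_eq_iff)
    next
      case False
      have "of_real \<epsilon> - w \<in> spectrum (star y * y)"
        by (rule mem_spectrum_mult_commute[OF False]) (use w in \<open>simp add: mem_spectrum_reflect\<close>)
      then have "w \<in> spectrum (\<epsilon> *\<^sub>R 1 - star y * y)" by (simp add: mem_spectrum_reflect)
      then show ?thesis using upper unfolding cstar_positive_iff_Re by blast
    qed
  qed
  moreover have "cstar_positive (star y * y + y * star y)"
  proof -
    \<comment> \<open>Up to sign, twice the real and imaginary parts of \<open>y\<close>; in the sum
      of their squares the terms \<open>y * y\<close> and \<open>star y * star y\<close>
      cancel.\<close>
    let ?u = "y + star y" and ?v = "\<i> *\<^sub>C (y - star y)"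
    have "?u * ?u + ?v * ?v = 2 *\<^sub>R (star y * y + y * star y)"
      by (simp add: mult_scaleC_left mult_scaleC_right scaleC_scaleC scaleC_minus_left
          scaleC_diff_right scaleR_2 algebra_simps)
    then have "star y * y + y * star y = (1 / 2) *\<^sub>R (?u * ?u + ?v * ?v)" by simp
    moreover have "star ?u = ?u" "star ?v = ?v"
      by (simp_all add: star_add star_star star_scaleC star_diff scaleC_minus_left scaleC_minus_right[symmetric])
    ultimately show ?thesis
      by (metis cstar_positive_add cstar_positive_scaleR cstar_positive_selfadjoint_square zero_le_divide_1_iff zero_le_numeral)
  qed
  ultimately have lower: "cstar_positive (star y * y + \<epsilon> *\<^sub>R 1)"
    using cstar_positive_add by fastforce
  have "- of_real (1 / \<alpha>) \<in> spectrum (star y * y)"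
  proof (rule ccontr)
    \<comment> \<open>The scalar identity is \<open>1 + \<alpha> t / (t + 2 \<alpha>)\<^sup>2 = (t +
      \<alpha>) (t + 4 \<alpha>) / (t + 2 \<alpha>)\<^sup>2\<close>; an inverse of the left side
      would yield one of \<open>?p\<close>, although \<open>z = - \<alpha>\<close> is a spectral
      point of \<open>b\<close>.\<close>
    let ?p = "b + \<alpha> *\<^sub>R 1" and ?q = "b + (4 * \<alpha>) *\<^sub>R 1"
    assume "\<not> ?thesis"
    then have "invertible_elem (of_real (- \<alpha>) *\<^sub>C (- of_real (1 / \<alpha>) *\<^sub>C 1 - star y * y))"
      using \<alpha>(1) by (intro invertible_elem_scaleC) (auto simp: mem_spectrum_iff)
    moreover have "of_real (- \<alpha>) *\<^sub>C (- of_real (1 / \<alpha>) *\<^sub>C 1 - star y * y) = 1 + \<alpha> *\<^sub>R (d * b * d)"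
      using \<alpha>(1)
      by (simp add: yy scaleC_diff_right scaleC_scaleC scaleC_minus_left scaleC_minus_right
          scaleC_of_real[symmetric])
    moreover have "1 + \<alpha> *\<^sub>R (d * b * d) = d * (?p * ?q) * d"
    proof -
      have pq: "?p * ?q = B * B + \<alpha> *\<^sub>R b"
        by (simp add: B_def algebra_simps scaleR_add_left[symmetric])
      have "d * (?p * ?q) * d = d * B * (B * d) + \<alpha> *\<^sub>R (d * b * d)"
        unfolding pq by (simp add: distrib_left distrib_right mult.assoc)
      then show ?thesis by (simp add: d)
    qed
    ultimately have "invertible_elem (B * (d * (?p * ?q) * d) * B)"
      using invB by (simp add: invertible_elem_mult)
    moreover have "B * (d * (?p * ?q) * d) * B = B * d * (?p * ?q) * (d * B)"
      by (simp only: mult.assoc)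
    ultimately have "invertible_elem (?p * ?q)" by (simp add: d)
    moreover have "?p * ?q = ?q * ?p" by (simp add: algebra_simps)
    ultimately have "invertible_elem ?p" by (rule invertible_elem_of_commuting_mult[rotated])
    then have "invertible_elem ((-1) *\<^sub>C ?p)" by (intro invertible_elem_scaleC) auto
    moreover have "(-1) *\<^sub>C ?p = z *\<^sub>C 1 - b"
      by (simp add: z_eq eq_diff_eq scaleC_minus_left scaleC_of_real)
    ultimately show False using z(1) by (simp add: mem_spectrum_iff)
  qed
  then have "- of_real (1 / \<alpha>) + of_real \<epsilon> \<in> spectrum (star y * y + \<epsilon> *\<^sub>R 1)"
    using mem_spectrum_shift[of "- of_real (1 / \<alpha>)" "of_real \<epsilon>" "star y * y"] by (simp add: scaleC_of_real)
  then have "0 \<le> Re (- of_real (1 / \<alpha>) + of_real \<epsilon>)"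
    using lower unfolding cstar_positive_iff_Re by blast
  then show False using \<alpha>(1) by (simp add: \<epsilon>_def field_simps)
qed

subsection \<open>Sums and operators on Banach spaces\<close>

text \<open>The Cauchy criterion for the net of finite sums, in a form that lets the tails of one
  series dominate those of another.\<close>

lemma summable_on_iff_small_tails:
  fixes f :: "'j \<Rightarrow> 'b::banach"
  shows "f summable_on A \<longleftrightarrow> (\<forall>e>0. \<exists>F0. finite F0 \<and> F0 \<subseteq> A \<and>
    (\<forall>F. finite F \<and> F \<subseteq> A \<and> F \<inter> F0 = {} \<longrightarrow> norm (sum f F) < e))"
    (is "_ \<longleftrightarrow> ?tails")
proof
  assume "f summable_on A"
  then obtain s where s: "(sum f \<longlongrightarrow> s) (finite_subsets_at_top A)"
    unfolding summable_on_def has_sum_def by blast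
  show ?tails
  proof (intro allI impI)
    fix e :: real assume "e > 0"
    then have "eventually (\<lambda>F. dist (sum f F) s < e / 2) (finite_subsets_at_top A)"
      using tendstoD[OF s, of "e / 2"] by simp
    then obtain F0 where F0: "finite F0" "F0 \<subseteq> A"
      "\<forall>F. finite F \<and> F0 \<subseteq> F \<and> F \<subseteq> A \<longrightarrow> dist (sum f F) s < e / 2"
      unfolding eventually_finite_subsets_at_top by (elim exE conjE)
    have "norm (sum f F) < e" if F: "finite F" "F \<subseteq> A" "F \<inter> F0 = {}" for F
    proof -
      have "dist (sum f (F \<union> F0)) s < e / 2" "dist (sum f F0) s < e / 2"
        using F F0 by auto
      then have "dist (sum f (F \<union> F0)) (sum f F0) < e"
        by (rule dist_triangle_half_l)
      then show ?thesis using F F0(1) by (simp add: sum.union_disjoint dist_norm)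
    qed
    then show "\<exists>F0. finite F0 \<and> F0 \<subseteq> A \<and>
        (\<forall>F. finite F \<and> F \<subseteq> A \<and> F \<inter> F0 = {} \<longrightarrow> norm (sum f F) < e)"
      using F0 by blast
  qed
next
  assume tails: ?tails
  have "\<exists>P. eventually P (finite_subsets_at_top A) \<and>
      (\<forall>F1 F2. P F1 \<and> P F2 \<longrightarrow> dist (sum f F1) (sum f F2) < e)" if "e > 0" for e
  proof -
    have "\<exists>F0. finite F0 \<and> F0 \<subseteq> A \<and>
        (\<forall>F. finite F \<and> F \<subseteq> A \<and> F \<inter> F0 = {} \<longrightarrow> norm (sum f F) < e / 2)"
      using tails that by (meson half_gt_zero)
    then obtain F0 where F0: "finite F0" "F0 \<subseteq> A"
      "\<forall>F. finite F \<and> F \<subseteq> A \<and> F \<inter> F0 = {} \<longrightarrow> norm (sum f F) < e / 2"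
      by (elim exE conjE)
    let ?P = "\<lambda>F. finite F \<and> F0 \<subseteq> F \<and> F \<subseteq> A"
    have near: "dist (sum f F) (sum f F0) < e / 2" if "?P F" for F
    proof -
      have "norm (sum f (F - F0)) < e / 2" using that by (intro F0(3)[rule_format]) auto
      then show ?thesis using that by (simp add: sum_diff dist_norm)
    qed
    have "dist (sum f F1) (sum f F2) < e" if "?P F1" "?P F2" for F1 F2
      using dist_triangle_half_l[OF near[OF that(1)] near[OF that(2)]] .
    moreover have "eventually ?P (finite_subsets_at_top A)"
      using F0(1,2) unfolding eventually_finite_subsets_at_top by blast
    ultimately show ?thesis by (intro exI[of _ ?P]) blast
  qed
  then have "cauchy_filter (filtermap (sum f) (finite_subsets_at_top A))"
    by (simp add: cauchy_filter_metric_filtermap)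
  moreover have "complete (UNIV :: 'b set)"
    by (meson Cauchy_convergent UNIV_I complete_def convergent_def)
  ultimately show "f summable_on A"
    using complete_uniform[where S = UNIV] unfolding summable_on_def has_sum_def
    by (force simp: filterlim_def)
qed

text \<open>The cone is closed under sums and limits; a family that is not summable has the default
  sum 0, which is positive.\<close>

lemma cstar_positive_infsum:
  assumes "\<And>j. j \<in> A \<Longrightarrow> cstar_positive (f j)"
  shows "cstar_positive (infsum f A)"
proof (cases "f summable_on A")
  case True
  then have "(sum f \<longlongrightarrow> infsum f A) (finite_subsets_at_top A)" by (rule infsum_tendsto)
  then show ?thesis
    by (rule cstar_positive_tendsto)
      (use assms in \<open>auto intro!: eventually_finite_subsets_at_top_weakI cstar_positive_sum\<close>)
qed (simp add: infsum_not_exists)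

text \<open>Method of continuity in \<open>\<lambda>\<close> for \<open>T + \<lambda>\<close>: it is onto for large \<open>\<lambda>\<close>, and the uniform lower
  bound allows steps of fixed size down to \<open>\<lambda> = 0\<close>.\<close>

lemma surj_of_shifts_bounded_below:
  fixes T :: "'h::banach \<Rightarrow> 'h"
  assumes T: "bounded_linear T" and c: "c > 0"
    and below: "\<And>l f. 0 \<le> l \<Longrightarrow> c * norm f \<le> norm (T f + l *\<^sub>R f)"
  shows "surj T"
proof -
  interpret T: bounded_linear T by fact
  obtain K where K: "K > 0" "\<And>f. norm (T f) \<le> norm f * K" using T.pos_bounded by blast
  let ?S = "\<lambda>l f. T f + l *\<^sub>R f"
  have large: "surj (?S (2 * K))"
    unfolding surj_def
  proof
    fix y
    have "\<exists>!f. (1 / (2 * K)) *\<^sub>R (y - T f) = f"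
    proof (rule banach_fix_type[where c = "1 / 2"]; (intro allI)?)
      fix f g
      have "dist ((1 / (2 * K)) *\<^sub>R (y - T f)) ((1 / (2 * K)) *\<^sub>R (y - T g)) = norm (T (g - f)) / (2 * K)"
        using K(1) by (simp add: dist_norm scaleR_diff_right[symmetric] T.diff)
      also have "\<dots> \<le> norm (g - f) * K / (2 * K)"
        using K by (intro divide_right_mono) auto
      finally show "dist ((1 / (2 * K)) *\<^sub>R (y - T f)) ((1 / (2 * K)) *\<^sub>R (y - T g)) \<le> 1 / 2 * dist f g"
        using K(1) by (simp add: dist_norm norm_minus_commute)
    qed auto
    then obtain f where "(1 / (2 * K)) *\<^sub>R (y - T f) = f" by blast
    then have "(2 * K) *\<^sub>R ((1 / (2 * K)) *\<^sub>R (y - T f)) = (2 * K) *\<^sub>R f" by simp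
    then have "y = ?S (2 * K) f" using K(1) by (simp add: diff_eq_eq add.commute)
    then show "\<exists>f. y = ?S (2 * K) f" by blast
  qed
  \<comment> \<open>A right inverse \<open>?G\<close> of the shift by \<open>l\<close> is Lipschitz
    with constant \<open>1 / c\<close>, so solving for the shift by \<open>l'\<close> is a fixed
    point problem with contraction constant \<open>1 / 2\<close>.\<close>
  have step: "surj (?S l')" if l: "0 \<le> l" "0 \<le> l'" "\<bar>l - l'\<bar> \<le> c / 2" and s: "surj (?S l)" for l l'
    unfolding surj_def
  proof
    fix y
    let ?G = "inv (?S l)"
    have G: "T (?G x) + l *\<^sub>R ?G x = x" for x using surj_f_inv_f[OF s, of x] by simp
    have lip: "c * dist (?G x) (?G z) \<le> dist x z" for x z
    proof -
      have "T (?G x - ?G z) + l *\<^sub>R (?G x - ?G z) = (T (?G x) + l *\<^sub>R ?G x) - (T (?G z) + l *\<^sub>R ?G z)"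
        by (simp add: T.diff scaleR_diff_right)
      also have "\<dots> = x - z" by (simp only: G)
      finally show ?thesis using below[OF l(1), of "?G x - ?G z"] by (simp add: dist_norm)
    qed
    have "\<exists>!f. ?G (y + (l - l') *\<^sub>R f) = f"
    proof (rule banach_fix_type[where c = "1 / 2"]; (intro allI)?)
      fix f g
      have "c * dist (?G (y + (l - l') *\<^sub>R f)) (?G (y + (l - l') *\<^sub>R g)) \<le> \<bar>l - l'\<bar> * dist f g"
        using lip[of "y + (l - l') *\<^sub>R f" "y + (l - l') *\<^sub>R g"]
        by (simp add: dist_norm scaleR_diff_right[symmetric])
      also have "\<dots> \<le> c / 2 * dist f g" using l(3) by (intro mult_right_mono) auto
      finally show "dist (?G (y + (l - l') *\<^sub>R f)) (?G (y + (l - l') *\<^sub>R g)) \<le> 1 / 2 * dist f g"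
        using c by simp
    qed auto
    then obtain f where f: "?G (y + (l - l') *\<^sub>R f) = f" by blast
    have "T f + l *\<^sub>R f = y + (l - l') *\<^sub>R f" using G[of "y + (l - l') *\<^sub>R f"] unfolding f .
    then have "y = ?S l' f" by (simp add: scaleR_diff_left algebra_simps)
    then show "\<exists>f. y = ?S l' f" by blast
  qed
  \<comment> \<open>The cutoff keeps the shifts nonnegative, as the lower bound requires, and makes
    the descent end exactly at 0.\<close>
  have "surj (?S (max 0 (2 * K - real n * (c / 2))))" for n
  proof (induction n)
    case 0
    then show ?case using large K(1) by simp
  next
    case (Suc n)
    show ?case
      by (rule step[OF _ _ _ Suc]) (use c in \<open>auto simp: max_def algebra_simps\<close>)
  qed
  moreover obtain n where "2 * K < real n * (c / 2)"
    using reals_Archimedean3[of "c / 2"] c by (meson half_gt_zero)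
  then have "max 0 (2 * K - real n * (c / 2)) = 0" by simp
  ultimately have "surj (?S 0)" by metis
  then show ?thesis by simp
qed

lemma GL_I:
  fixes T :: "'h::complex_banach \<Rightarrow> 'h"
  assumes T: "bounded_clinear T" and c: "c > 0" and below: "\<And>f. c * norm f \<le> norm (T f)"
    and s: "surj T"
  shows "T \<in> GL"
proof -
  interpret T: bounded_linear T using T by (simp add: bounded_clinear_def)
  have Tc: "T (z *\<^sub>C f) = z *\<^sub>C T f" for z f using T by (simp add: bounded_clinear_def)
  have inj: "inj T"
  proof (rule injI)
    fix f g assume "T f = T g"
    then have "c * norm (f - g) \<le> 0" using below[of "f - g"] by (simp add: T.diff)
    then show "f = g" using c by (simp add: mult_le_0_iff)
  qed
  have TR: "T (inv T x) = x" for x by (rule surj_f_inv_f[OF s])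
  have RI: "inv T x = f" if "T f = x" for x f using inv_f_eq[OF inj that] .
  have "bounded_linear (inv T)"
  proof (rule bounded_linear_intro[where K = "1 / c"])
    show "norm (inv T x) \<le> norm x * (1 / c)" for x
      using below[of "inv T x"] c by (simp add: TR field_simps)
  qed (auto intro!: RI simp: T.add T.scaleR TR)
  moreover have "inv T (z *\<^sub>C x) = z *\<^sub>C inv T x" for z x by (rule RI) (simp add: Tc TR)
  moreover have "inv T \<circ> T = id" "T \<circ> inv T = id" using inj s TR by (auto simp: fun_eq_iff)
  ultimately show ?thesis using T unfolding GL_def bounded_clinear_def by blast
qed

subsection \<open>Sesquilinear forms\<close>

text \<open>Vector-valued, so that the inner product, the terms of the frame sum and their infinite
  sum share polarization.\<close>

locale sesquilinear =
  fixes B :: "'h::complex_banach \<Rightarrow> 'h \<Rightarrow> 'a::complex_banach"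
  assumes add_left: "B (f + g) h = B f h + B g h"
    and add_right: "B h (f + g) = B h f + B h g"
    and scaleC_left: "B (c *\<^sub>C f) g = c *\<^sub>C B f g"
    and scaleC_right: "B f (c *\<^sub>C g) = cnj c *\<^sub>C B f g"
begin

lemma scaleR_left: "B (r *\<^sub>R f) g = r *\<^sub>R B f g"
  using scaleC_left[of "of_real r" f g] by (simp add: scaleC_of_real)

lemma scaleR_right: "B f (r *\<^sub>R g) = r *\<^sub>R B f g"
  using scaleC_right[of f "of_real r" g] by (simp add: scaleC_of_real)

lemma minus_left: "B (- f) g = - B f g" using scaleR_left[of "-1" f g] by simp

lemma minus_right: "B f (- g) = - B f g" using scaleR_right[of f "-1" g] by simp

lemma diff_left: "B (f - g) h = B f h - B g h"
  using add_left[of f "- g" h] by (simp add: minus_left)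

lemma diff_right: "B h (f - g) = B h f - B h g"
  using add_right[of h f "- g"] by (simp add: minus_right)

lemma zero_left: "B 0 g = 0" using scaleR_left[of 0 0 g] by simp

lemma zero_right: "B f 0 = 0" using scaleR_right[of f 0 0] by simp

text \<open>The first difference is \<open>2 (B f g + B g f)\<close>; with
  \<open>\<i> *\<^sub>C g\<close> for \<open>g\<close> and the factor \<open>\<i>\<close> it becomes
  \<open>2 (B f g - B g f)\<close>.\<close>

lemma polarization:
  "B f g = (1 / 4) *\<^sub>R (B (f + g) (f + g) - B (f - g) (f - g)
     + \<i> *\<^sub>C (B (f + \<i> *\<^sub>C g) (f + \<i> *\<^sub>C g) - B (f - \<i> *\<^sub>C g) (f - \<i> *\<^sub>C g)))"
proof -
  have "B (f + g) (f + g) - B (f - g) (f - g) = 2 *\<^sub>R (B f g + B g f)" for g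
    by (simp add: add_left add_right diff_left diff_right scaleR_2 algebra_simps)
  then have "B (f + g) (f + g) - B (f - g) (f - g)
     + \<i> *\<^sub>C (B (f + \<i> *\<^sub>C g) (f + \<i> *\<^sub>C g) - B (f - \<i> *\<^sub>C g) (f - \<i> *\<^sub>C g))
     = 2 *\<^sub>R (B f g + B g f) + 2 *\<^sub>R (B f g - B g f)"
    by (simp add: scaleC_left scaleC_right scaleR_scaleC_commute[symmetric] scaleC_add_right
        scaleC_diff_right scaleC_scaleC scaleC_minus_left)
  also have "\<dots> = 4 *\<^sub>R B f g"
    by (simp add: scaleR_add_right scaleR_diff_right scaleR_add_left[symmetric])
  finally show ?thesis by simp
qed

text \<open>For unit vectors, polarization evaluates \<open>B\<close> at four vectors of norm at
  most 2, where it is at most \<open>4 * M\<close>; homogeneity does the rest.\<close>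

lemma bounded_of_diagonal:
  assumes M: "\<And>f. norm (B f f) \<le> M * (norm f)\<^sup>2"
  shows "norm (B f g) \<le> 4 * M * norm f * norm g"
proof (cases "f = 0 \<or> g = 0")
  case True
  then show ?thesis by (auto simp: zero_left zero_right)
next
  case False
  then have pos: "norm f > 0" "norm g > 0" by auto
  have "0 \<le> M * (norm f)\<^sup>2" using M[of f] norm_ge_zero order_trans by blast
  then have M0: "0 \<le> M" using pos by (simp add: zero_le_mult_iff)
  define x where "x = inverse (norm f) *\<^sub>R f"
  define y where "y = inverse (norm g) *\<^sub>R g"
  have n: "norm x = 1" "norm y = 1" "norm (\<i> *\<^sub>C y) = 1" using pos by (simp_all add: x_def y_def norm_scaleC)
  have le: "norm (B v v) \<le> 4 * M" if "norm v \<le> 2" for v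
  proof -
    have "(norm v)\<^sup>2 \<le> 2\<^sup>2" by (rule power_mono[OF that]) simp
    then have "M * (norm v)\<^sup>2 \<le> M * 4" using M0 by (intro mult_left_mono) auto
    then show ?thesis using M[of v] by simp
  qed
  have bd: "norm (B (x + u) (x + u) - B (x - u) (x - u)) \<le> 8 * M" if "norm u = 1" for u
  proof -
    have "norm (B (x + u) (x + u)) \<le> 4 * M" "norm (B (x - u) (x - u)) \<le> 4 * M"
      using norm_triangle_ineq[of x u] norm_triangle_ineq4[of x u] n that by (auto intro!: le)
    then show ?thesis using norm_triangle_ineq4[of "B (x + u) (x + u)" "B (x - u) (x - u)"] by linarith
  qed
  have "norm (B x y) \<le> (1 / 4) * (8 * M + 8 * M)"
    unfolding polarization[of x y] norm_scaleR
  proof (intro mult_mono norm_triangle_le add_mono)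
    show "norm (\<i> *\<^sub>C (B (x + \<i> *\<^sub>C y) (x + \<i> *\<^sub>C y) - B (x - \<i> *\<^sub>C y) (x - \<i> *\<^sub>C y))) \<le> 8 * M"
      using bd[OF n(3)] by (simp add: norm_scaleC)
  qed (use bd[OF n(2)] in auto)
  moreover have "B f g = (norm f * norm g) *\<^sub>R B x y"
    using less_imp_neq[OF pos(1)] less_imp_neq[OF pos(2)]
    by (simp add: x_def y_def scaleR_left scaleR_right mult_ac)
  then have "norm (B f g) = (norm f * norm g) * norm (B x y)" by simp
  ultimately have "norm (B f g) \<le> (norm f * norm g) * (4 * M)"
    by (simp add: mult_left_mono)
  then show ?thesis by (simp add: mult_ac)
qed

end

lemma sesquilinear_eqI:
  assumes "sesquilinear B" "sesquilinear B'" and eq: "\<And>f. B f f = B' f f"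
  shows "B f g = B' f g"
  unfolding sesquilinear.polarization[OF assms(1), of f g] sesquilinear.polarization[OF assms(2), of f g]
  by (simp only: eq)

lemma summable_on_diff_banach:
  fixes f g :: "'j \<Rightarrow> 'b::banach"
  shows "f summable_on A \<Longrightarrow> g summable_on A \<Longrightarrow> (\<lambda>j. f j - g j) summable_on A"
  using summable_on_add[of f A "\<lambda>j. - g j"] by (simp add: summable_on_uminus)

text \<open>Frames provide convergence on the diagonal only; polarization extends it to all
  pairs.\<close>

lemma sesquilinear_summable:
  assumes B: "\<And>j. sesquilinear (B j)" and sm: "\<And>f. (\<lambda>j. B j f f) summable_on J"
  shows "(\<lambda>j. B j f g) summable_on J"
  unfolding sesquilinear.polarization[OF B, of _ f g]
  by (intro summable_on_scaleR_right summable_on_add summable_on_bounded_linear[OF bounded_linear_scaleC] summable_on_diff_banach sm)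

lemma sesquilinear_infsum:
  assumes B: "\<And>j. sesquilinear (B j)" and sm: "\<And>f. (\<lambda>j. B j f f) summable_on J"
  shows "sesquilinear (\<lambda>f g. \<Sum>\<^sub>\<infinity>j\<in>J. B j f g)"
proof -
  note s = sesquilinear_summable[OF B sm]
  have sc: "(\<Sum>\<^sub>\<infinity>j\<in>J. c *\<^sub>C B j f g) = c *\<^sub>C (\<Sum>\<^sub>\<infinity>j\<in>J. B j f g)" for c f g
    by (rule infsum_bounded_linear_strong[OF _ bounded_linear_scaleC])
      (simp add: s summable_on_bounded_linear[OF bounded_linear_scaleC])
  show ?thesis
    by unfold_locales
      (simp_all add: sesquilinear.add_left[OF B] sesquilinear.add_right[OF B]
        sesquilinear.scaleC_left[OF B] sesquilinear.scaleC_right[OF B] infsum_add s sc)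
qed

subsection \<open>Hilbert modules\<close>

context hilbert_module
begin

text \<open>Derives complex homogeneity of \<open>ip\<close> from its linearity over the algebra, by
  writing scalars as multiples of the unit.\<close>

lemma scaleC_eq_act: "c *\<^sub>C f = (c *\<^sub>C 1) \<cdot> f"
  by (simp add: act_scaleC act_one)

lemma ip_scaleC_left: "ip (c *\<^sub>C f) g = c *\<^sub>C ip f g"
  by (subst scaleC_eq_act) (simp add: ip_act_left mult_scaleC_left)

lemma ip_add_right: "ip f (g + h) = ip f g + ip f h"
  by (metis ip_add_left ip_star star_add)

lemma ip_scaleC_right: "ip f (c *\<^sub>C g) = cnj c *\<^sub>C ip f g"
  by (metis ip_scaleC_left ip_star star_scaleC)

lemma sesquilinear_ip: "sesquilinear ip"
  by unfold_locales (simp_all add: ip_add_left ip_add_right ip_scaleC_left ip_scaleC_right)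

sublocale ip: sesquilinear ip by (rule sesquilinear_ip)

lemma norm_ip_self: "norm (ip f f) = (norm f)\<^sup>2"
  by (simp add: norm_ip)

text \<open>The factor 4 is the price of using polarization in place of the Cauchy--Schwarz inequality.\<close>

lemma norm_ip_le: "norm (ip f g) \<le> 4 * norm f * norm g"
  using ip.bounded_of_diagonal[of 1 f g] by (simp add: norm_ip_self)

lemma bounded_linear_ip_left: "bounded_linear (\<lambda>f. ip f g)"
  by (rule bounded_linear_intro[where K = "4 * norm g"])
    (use norm_ip_le in \<open>auto simp: ip_add_left ip.scaleR_left mult_ac\<close>)

lemma ip_sum_left: "ip (sum f F) g = (\<Sum>j\<in>F. ip (f j) g)"
  by (rule bounded_linear.linear[OF bounded_linear_ip_left, THEN linear_sum])

lemma eq_of_ip_left: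
  assumes "\<And>g. ip f g = ip f' g"
  shows "f = f'"
proof -
  have "ip (f - f') (f - f') = 0" by (simp add: ip.diff_left assms)
  then show ?thesis using ip_definite by force
qed

lemma eq_of_ip_right:
  assumes "\<And>g. ip g f = ip g f'"
  shows "f = f'"
  by (rule eq_of_ip_left) (metis assms ip_star)

lemma is_adjoint_swap: "is_adjoint ip T R \<Longrightarrow> is_adjoint ip R T"
  unfolding is_adjoint_def by (metis ip_star)

text \<open>Members of \<open>GL\<close> are only complex linear; the adjoint supplies the linearity
  over the algebra by which \<open>C\<close> passes into the frame sum.\<close>

lemma is_adjoint_act:
  assumes "is_adjoint ip T R"
  shows "T (a \<cdot> f) = a \<cdot> T f"
  by (rule eq_of_ip_left) (use assms in \<open>simp add: is_adjoint_def ip_act_left\<close>)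

text \<open>Linearity of \<open>R\<close> comes from nondegeneracy of \<open>ip\<close>, the bound
  from \<open>ip (T (R f)) f = ip (R f) (R f)\<close>. With \<open>T = R = S\<close> this also makes
  the frame operator linear.\<close>

lemma is_adjoint_bounded_clinear:
  assumes TR: "is_adjoint ip T R" and K: "\<And>f. norm (T f) \<le> K * norm f"
  shows "bounded_clinear R"
proof -
  have e: "ip g (R f) = ip (T g) f" for f g using TR by (simp add: is_adjoint_def)
  have "norm (R f) \<le> 4 * K * norm f" for f
  proof (cases "R f = 0")
    case True
    have "0 \<le> K * norm f" using K[of f] norm_ge_zero order_trans by blast
    then show ?thesis using True by simp
  next
    case False
    have "norm (R f) * norm (R f) = norm (ip (T (R f)) f)"
      by (simp add: norm_ip_self e[symmetric] power2_eq_square[symmetric])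
    also have "\<dots> \<le> 4 * norm (T (R f)) * norm f" by (rule norm_ip_le)
    also have "\<dots> \<le> 4 * (K * norm (R f)) * norm f"
      by (intro mult_right_mono mult_left_mono K) auto
    also have "\<dots> = 4 * K * norm f * norm (R f)" by (simp add: mult_ac)
    finally show ?thesis using False by simp
  qed
  then have "bounded_linear R"
    by (intro bounded_linear_intro[where K = "4 * K"])
      (auto intro!: eq_of_ip_right simp: ip_add_right ip.scaleR_right e mult_ac)
  moreover have "R (c *\<^sub>C f) = c *\<^sub>C R f" for c f
    by (rule eq_of_ip_right) (simp add: ip_scaleC_right e)
  ultimately show ?thesis by (simp add: bounded_clinear_def)
qed

section \<open>Coercive operators\<close>

lemma coercive_bounded_below:
  assumes pos: "\<And>f. cstar_positive (ip (T f) f)"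
    and m: "\<And>f. m * (norm f)\<^sup>2 \<le> norm (ip (T f) f)" and l: "0 \<le> l"
  shows "m / 4 * norm f \<le> norm (T f + l *\<^sub>R f)"
proof (cases "f = 0")
  case False
  have "m * (norm f)\<^sup>2 \<le> norm (ip (T f) f)" by (rule m)
  \<comment> \<open>The shift adds the positive element \<open>l *\<^sub>R ip f f\<close>, so the
    norm cannot decrease.\<close>
  also have "\<dots> \<le> norm (ip (T f + l *\<^sub>R f) f)"
    by (rule norm_mono_cstar_positive[OF pos])
      (use l in \<open>simp add: ip_add_left ip.scaleR_left cstar_positive_scaleR ip_positive\<close>)
  also have "\<dots> \<le> 4 * norm (T f + l *\<^sub>R f) * norm f" by (rule norm_ip_le)
  finally have "m * norm f * norm f \<le> 4 * norm (T f + l *\<^sub>R f) * norm f"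
    by (simp add: power2_eq_square mult.assoc)
  then have "m * norm f \<le> 4 * norm (T f + l *\<^sub>R f)" using False by simp
  then show ?thesis by simp
qed simp

text \<open>A Lax-Milgram argument: coercivity bounds all shifts by \<open>l \<ge> 0\<close> from
  below uniformly, which gives surjectivity by continuity and a bound for the inverse.\<close>

lemma coercive_GL:
  assumes T: "bounded_clinear T" and pos: "\<And>f. cstar_positive (ip (T f) f)"
    and m: "0 < m" "\<And>f. m * (norm f)\<^sup>2 \<le> norm (ip (T f) f)"
  shows "T \<in> GL"
proof (rule GL_I[OF T])
  note below = coercive_bounded_below[OF pos m(2)]
  show "0 < m / 4" using m(1) by simp
  then show "surj T"
    using T below by (intro surj_of_shifts_bounded_below[of T "m / 4"]) (auto simp: bounded_clinear_def)
  show "m / 4 * norm f \<le> norm (T f)" for f using below[of 0 f] by simp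
qed

text \<open>A bijective adjointable \<open>C\<close> makes \<open>C\<^sup>*C\<close> coercive, which yields a bounded right inverse
  of \<open>C\<^sup>*\<close>.\<close>

lemma adjoint_bounded_right_inverse:
  assumes C: "C \<in> GL" and D: "is_adjoint ip C D"
  shows "\<exists>G L. (\<forall>f. D (G f) = f) \<and> (\<forall>f. norm (G f) \<le> L * norm f)"
proof -
  obtain R where R: "bounded_linear R" "R \<circ> C = id" and bC: "bounded_clinear C"
    using C by (auto simp: GL_def bounded_clinear_def)
  have Cl: "bounded_linear C" using bC by (simp add: bounded_clinear_def)
  obtain k where k: "\<And>f. norm (C f) \<le> norm f * k" "k > 0"
    using bounded_linear.pos_bounded[OF Cl] by blast
  obtain r where r: "\<And>f. norm (R f) \<le> norm f * r" "r > 0"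
    using bounded_linear.pos_bounded[OF R(1)] by blast
  have bD: "bounded_clinear D"
    by (rule is_adjoint_bounded_clinear[OF D, of k]) (subst mult.commute, rule k)
  have DC: "ip (D (C f)) f = ip (C f) (C f)" for f
    using is_adjoint_swap[OF D] by (simp add: is_adjoint_def)
  have "(D \<circ> C) \<in> GL"
  proof (rule coercive_GL)
    show "bounded_clinear (D \<circ> C)"
      using bC bD bounded_linear_compose[of D C] by (simp add: bounded_clinear_def comp_def)
    show "cstar_positive (ip ((D \<circ> C) f) f)" for f by (simp add: DC ip_positive)
    show "0 < 1 / r\<^sup>2" using r(2) by simp
    show "1 / r\<^sup>2 * (norm f)\<^sup>2 \<le> norm (ip ((D \<circ> C) f) f)" for f
    proof -
      have "norm f \<le> norm (C f) * r" using r(1)[of "C f"] R(2) by (simp add: fun_eq_iff)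
      then have "(norm f)\<^sup>2 \<le> (norm (C f) * r)\<^sup>2" by (rule power_mono) simp
      then show ?thesis using r(2) by (simp add: DC norm_ip_self power_mult_distrib divide_simps)
    qed
  qed
  then obtain Q where Q: "bounded_linear Q" "D \<circ> C \<circ> Q = id"
    by (auto simp: GL_def bounded_clinear_def)
  obtain q where q: "\<And>f. norm (Q f) \<le> norm f * q" "q > 0"
    using bounded_linear.pos_bounded[OF Q(1)] by blast
  show ?thesis
  proof (intro exI conjI allI)
    show "D ((C \<circ> Q) f) = f" for f using Q(2) by (simp add: fun_eq_iff)
    show "norm ((C \<circ> Q) f) \<le> (q * k) * norm f" for f
    proof -
      have "norm (C (Q f)) \<le> norm (Q f) * k" by (rule k)
      also have "\<dots> \<le> norm f * q * k" using k(2) by (intro mult_right_mono q) auto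
      finally show ?thesis by (simp add: mult_ac)
    qed
  qed
qed

section \<open>Convergence of the frame series\<close>

lemma cstar_positive_mult_ip: "cstar_positive (ip f g * ip g f)"
  using cstar_positive_star_mult_self[of "ip g f"] by (simp add: ip_star)

text \<open>The terms \<open>ip h (\<psi> j) * ip (\<psi> j) h\<close> are positive, so the bound
  \<open>K\<close> passes to finite subsums. It bounds the squared norm of a finite piece of the
  vector series by a multiple of the norm of the same piece of the given series, and the Cauchy
  criterion applies.\<close>

lemma summable_synthesis:
  assumes sm: "\<And>f. (\<lambda>j. ip f (\<psi> j) * ip (\<psi> j) f) summable_on J"
    and K: "\<And>f. norm (\<Sum>\<^sub>\<infinity>j\<in>J. ip f (\<psi> j) * ip (\<psi> j) f) \<le> K * (norm f)\<^sup>2"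
  shows "(\<lambda>j. ip f (\<psi> j) \<cdot> \<psi> j) summable_on J"
proof -
  define k where "k = \<bar>K\<bar> + 1"
  have k: "k > 0" "K \<le> k" by (auto simp: k_def)
  have bessel: "norm (\<Sum>j\<in>F. ip h (\<psi> j) * ip (\<psi> j) h) \<le> k * (norm h)\<^sup>2"
    if F: "finite F" "F \<subseteq> J" for F h
  proof -
    let ?t = "\<lambda>j. ip h (\<psi> j) * ip (\<psi> j) h"
    have "infsum ?t (J - F) = infsum ?t J - infsum ?t F"
      using sm[of h] F by (intro infsum_Diff) auto
    then have "cstar_positive (infsum ?t J - sum ?t F)"
      using F cstar_positive_infsum[of "J - F" ?t] by (simp add: cstar_positive_mult_ip)
    then have "norm (sum ?t F) \<le> norm (infsum ?t J)"
      by (intro norm_mono_cstar_positive cstar_positive_sum cstar_positive_mult_ip)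
    also have "\<dots> \<le> K * (norm h)\<^sup>2" by (rule K)
    also have "\<dots> \<le> k * (norm h)\<^sup>2" by (intro mult_right_mono k) auto
    finally show ?thesis .
  qed
  have tail: "(norm (\<Sum>j\<in>F. ip f (\<psi> j) \<cdot> \<psi> j))\<^sup>2 \<le> k * norm (\<Sum>j\<in>F. ip f (\<psi> j) * ip (\<psi> j) f)"
    if F: "finite F" "F \<subseteq> J" for F
  proof -
    define h where "h = (\<Sum>j\<in>F. ip f (\<psi> j) \<cdot> \<psi> j)"
    let ?A = "\<Sum>j\<in>F. ip f (\<psi> j) * ip (\<psi> j) f" and ?B = "\<Sum>j\<in>F. ip h (\<psi> j) * ip (\<psi> j) h"
    have hh: "(\<Sum>j\<in>F. ip f (\<psi> j) * ip (\<psi> j) h) = ip h h"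
      using arg_cong[OF h_def, of "\<lambda>x. ip x h"] by (simp add: ip_sum_left ip_act_left)
    have hh': "(\<Sum>j\<in>F. ip h (\<psi> j) * ip (\<psi> j) f) = ip h h"
    proof -
      have "(\<Sum>j\<in>F. ip h (\<psi> j) * ip (\<psi> j) f) = star (\<Sum>j\<in>F. ip f (\<psi> j) * ip (\<psi> j) h)"
        by (simp add: linear_sum[OF bounded_linear.linear[OF bounded_linear_star]] star_mult ip_star)
      then show ?thesis by (simp add: hh ip_star)
    qed
    \<comment> \<open>Replaces Cauchy-Schwarz: both cross terms equal \<open>ip h h\<close>, so
      \<open>2 k\<close> times it is at most \<open>k\<^sup>2 *\<^sub>R ?A + ?B\<close>. As
      \<open>norm ?B\<close> is at most \<open>k * (norm h)\<^sup>2\<close>, half of the left side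
      absorbs it.\<close>
    have "cstar_positive (\<Sum>j\<in>F. ip (k *\<^sub>R f - h) (\<psi> j) * ip (\<psi> j) (k *\<^sub>R f - h))"
      by (intro cstar_positive_sum cstar_positive_mult_ip)
    also have "(\<Sum>j\<in>F. ip (k *\<^sub>R f - h) (\<psi> j) * ip (\<psi> j) (k *\<^sub>R f - h))
        = k\<^sup>2 *\<^sub>R ?A - k *\<^sub>R (\<Sum>j\<in>F. ip f (\<psi> j) * ip (\<psi> j) h)
          - k *\<^sub>R (\<Sum>j\<in>F. ip h (\<psi> j) * ip (\<psi> j) f) + ?B"
      by (simp add: ip.diff_left ip.diff_right ip.scaleR_left ip.scaleR_right left_diff_distrib
          right_diff_distrib scaleR_diff_right sum.distrib sum_subtractf scaleR_sum_right power2_eq_square)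
    also have "\<dots> = (k\<^sup>2 *\<^sub>R ?A + ?B) - (2 * k) *\<^sub>R ip h h"
      unfolding hh hh' by (simp add: scaleR_add_left[symmetric] diff_diff_add)
    finally have "norm ((2 * k) *\<^sub>R ip h h) \<le> norm (k\<^sup>2 *\<^sub>R ?A + ?B)"
      using k(1) by (intro norm_mono_cstar_positive cstar_positive_scaleR ip_positive) auto
    also have "\<dots> \<le> k\<^sup>2 * norm ?A + norm ?B"
      using norm_triangle_ineq[of "k\<^sup>2 *\<^sub>R ?A" ?B] by simp
    also have "\<dots> \<le> k\<^sup>2 * norm ?A + k * (norm h)\<^sup>2"
      using bessel[OF F, of h] by simp
    finally have "k * (norm h)\<^sup>2 \<le> k * (k * norm ?A)"
      using k(1) by (simp add: norm_ip_self power2_eq_square)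
    then show ?thesis using k(1) by (simp add: h_def)
  qed
  show ?thesis
    unfolding summable_on_iff_small_tails
  proof (intro allI impI)
    fix e :: real assume e: "e > 0"
    then have "e\<^sup>2 / k > 0" using k(1) by simp
    with sm[of f] obtain F0 where F0: "finite F0" "F0 \<subseteq> J" and
      small: "\<forall>F. finite F \<and> F \<subseteq> J \<and> F \<inter> F0 = {} \<longrightarrow>
        norm (\<Sum>j\<in>F. ip f (\<psi> j) * ip (\<psi> j) f) < e\<^sup>2 / k"
      unfolding summable_on_iff_small_tails by meson
    have "norm (\<Sum>j\<in>F. ip f (\<psi> j) \<cdot> \<psi> j) < e" if F: "finite F" "F \<subseteq> J" "F \<inter> F0 = {}" for F
    proof (rule power_less_imp_less_base)
      have "k * norm (\<Sum>j\<in>F. ip f (\<psi> j) * ip (\<psi> j) f) < e\<^sup>2"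
        using small F k(1) by (simp add: less_divide_eq mult.commute)
      then show "(norm (\<Sum>j\<in>F. ip f (\<psi> j) \<cdot> \<psi> j))\<^sup>2 < e\<^sup>2"
        using tail[OF F(1,2)] by linarith
    qed (use e in simp)
    then show "\<exists>F0. finite F0 \<and> F0 \<subseteq> J \<and> (\<forall>F. finite F \<and> F \<subseteq> J \<and> F \<inter> F0 = {} \<longrightarrow>
        norm (\<Sum>j\<in>F. ip f (\<psi> j) \<cdot> \<psi> j) < e)"
      using F0 by blast
  qed
qed

text \<open>Convergence of the series belongs to the conclusion, because \<open>infsum\<close> would
  be 0 for a family that is not summable.\<close>

theorem controlled_frame_operator_properties:
  assumes C: "C \<in> GL" "adjointable ip C" and frame: "controlled_frame ip C \<psi> J m M"
  defines "S \<equiv> controlled_frame_operator act ip C \<psi> J"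
  shows "\<And>f. (\<lambda>j. ip f (\<psi> j) \<cdot> C (\<psi> j)) summable_on J"
    and "S \<in> GL" "positive_operator ip S" "selfadjoint ip S"
proof -
  define Q where "Q = (\<lambda>f g. \<Sum>\<^sub>\<infinity>j\<in>J. ip f (\<psi> j) * ip (C (\<psi> j)) g)"
  have m: "m > 0" and sm: "\<And>f. (\<lambda>j. ip f (\<psi> j) * ip (C (\<psi> j)) f) summable_on J"
    and upper: "\<And>f. cstar_positive (M *\<^sub>R ip f f - Q f f)"
    and lower: "\<And>f. cstar_positive (Q f f - m *\<^sub>R ip f f)"
    using frame by (auto simp: controlled_frame_def controlled_bessel_def cstar_le_def Q_def)
  have ss: "sesquilinear (\<lambda>f g. ip f (\<psi> j) * ip (C (\<psi> j)) g)" for j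
    by unfold_locales (simp_all add: ip_add_left ip_add_right ip_scaleC_left ip_scaleC_right
        distrib_left distrib_right mult_scaleC_left mult_scaleC_right)
  note sm' = sesquilinear_summable[OF ss sm]
  interpret Q: sesquilinear Q unfolding Q_def by (rule sesquilinear_infsum[OF ss sm])
  have posQ: "cstar_positive (Q f f)" for f
    using cstar_positive_add[OF lower[of f] cstar_positive_scaleR[OF ip_positive[of f], of m]] m by simp
  \<comment> \<open>\<open>controlled_frame\<close> fixes no sign for \<open>M\<close>, hence the
    absolute value.\<close>
  have "norm (Q f f) \<le> \<bar>M\<bar> * (norm f)\<^sup>2" for f
    using norm_mono_cstar_positive[OF posQ upper, of f] by (simp add: norm_ip_self)
  then have bQ: "norm (Q f g) \<le> 4 * \<bar>M\<bar> * norm f * norm g" for f g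
    by (rule Q.bounded_of_diagonal)
  obtain D where D: "is_adjoint ip C D" using C(2) by (auto simp: adjointable_def)
  obtain G L where G: "D (G f) = f" "norm (G f) \<le> L * norm f" for f
    using adjoint_bounded_right_inverse[OF C(1) D] by auto
  \<comment> \<open>Taking \<open>G f\<close> as second argument of \<open>Q\<close> trades
    \<open>C (\<psi> j)\<close> for \<open>\<psi> j\<close>, so the controlled sum becomes an
    ordinary one with positive terms.\<close>
  have CD: "ip (C (\<psi> j)) (G f) = ip (\<psi> j) f" for j f
    using D by (simp add: is_adjoint_def G(1))
  have syn: "(\<lambda>j. ip f (\<psi> j) \<cdot> \<psi> j) summable_on J" for f
  proof (rule summable_synthesis)
    show "(\<lambda>j. ip f (\<psi> j) * ip (\<psi> j) f) summable_on J" for f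
      using sm'[of f "G f"] by (simp add: CD)
    show "norm (\<Sum>\<^sub>\<infinity>j\<in>J. ip f (\<psi> j) * ip (\<psi> j) f) \<le> 4 * \<bar>M\<bar> * L * (norm f)\<^sup>2" for f
    proof -
      have "(\<Sum>\<^sub>\<infinity>j\<in>J. ip f (\<psi> j) * ip (\<psi> j) f) = Q f (G f)" by (simp add: Q_def CD)
      also have "norm \<dots> \<le> 4 * \<bar>M\<bar> * norm f * norm (G f)" by (rule bQ)
      also have "\<dots> \<le> 4 * \<bar>M\<bar> * norm f * (L * norm f)" by (intro mult_left_mono G) auto
      finally show ?thesis by (simp add: power2_eq_square mult_ac)
    qed
  qed
  have Cl: "bounded_linear C" using C(1) by (auto simp: GL_def bounded_clinear_def)
  show sumC: "(\<lambda>j. ip f (\<psi> j) \<cdot> C (\<psi> j)) summable_on J" for f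
    using summable_on_bounded_linear[OF Cl syn[of f]] by (simp add: is_adjoint_act[OF D])
  have S: "ip (S f) g = Q f g" for f g
    unfolding S_def controlled_frame_operator_def Q_def
    using infsumI[OF has_sum_bounded_linear[OF bounded_linear_ip_left[of g] has_sum_infsum[OF sumC[of f]]]]
    by (simp add: ip_act_left)
  \<comment> \<open>Diagonal values of \<open>Q\<close> are positive, hence self-adjoint; the two
    forms agree there, and by polarization everywhere.\<close>
  have "Q f g = star (Q g f)" for f g
  proof (rule sesquilinear_eqI[where B' = "\<lambda>f g. star (Q g f)"])
    show "sesquilinear Q" by (rule Q.sesquilinear_axioms)
    show "sesquilinear (\<lambda>f g. star (Q g f))"
      by unfold_locales (simp_all add: Q.add_left Q.add_right Q.scaleC_left Q.scaleC_right star_add star_scaleC)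
    show "Q f f = star (Q f f)" for f using cstar_positive_selfadjoint[OF posQ] by simp
  qed
  then have SS: "is_adjoint ip S S" unfolding is_adjoint_def S by (metis S ip_star)
  then show "selfadjoint ip S" by (simp add: selfadjoint_def)
  show "positive_operator ip S" by (simp add: positive_operator_def cstar_le_def S posQ)
  have "norm (S f) \<le> 4 * \<bar>M\<bar> * norm f" for f
  proof (cases "S f = 0")
    case False
    have "norm (S f) * norm (S f) = norm (Q f (S f))"
      by (simp add: S[symmetric] norm_ip_self power2_eq_square)
    also have "\<dots> \<le> 4 * \<bar>M\<bar> * norm f * norm (S f)" by (rule bQ)
    finally show ?thesis using False by simp
  qed simp
  then have "bounded_clinear S" by (rule is_adjoint_bounded_clinear[OF SS])
  then show "S \<in> GL"
  proof (rule coercive_GL[OF _ _ m])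
    show "cstar_positive (ip (S f) f)" for f by (simp add: S posQ)
    show "m * (norm f)\<^sup>2 \<le> norm (ip (S f) f)" for f
    proof -
      have "norm (m *\<^sub>R ip f f) \<le> norm (Q f f)"
        using m by (intro norm_mono_cstar_positive lower cstar_positive_scaleR ip_positive) auto
      then show ?thesis using m by (simp add: norm_ip_self S)
    qed
  qed
qed

end

theorem proposition3p4:
  fixes act :: "'a::unital_cstar_algebra \<Rightarrow> 'h::complex_banach \<Rightarrow> 'h"
    and ip :: "'h \<Rightarrow> 'h \<Rightarrow> 'a"
    and C :: "'h \<Rightarrow> 'h"
    and J :: "'j set"
    and \<psi> :: "'j \<Rightarrow> 'h"
    and m M :: real
  assumes "hilbert_module act ip"
    and "finitely_generated act \<or> countably_generated act"
    and "C \<in> GL"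
    and "adjointable ip C"
    and "countable J"
    and "m > 0" and "M > 0"
    and "controlled_frame ip C \<psi> J m M"
  defines "S \<equiv> controlled_frame_operator act ip C \<psi> J"
  shows "(\<forall>f. (\<lambda>j. act (ip f (\<psi> j)) (C (\<psi> j))) summable_on J) \<and>
    S \<in> GL \<and> positive_operator ip S \<and> adjointable ip S \<and> selfadjoint ip S"
proof -
  note props = hilbert_module.controlled_frame_operator_properties[OF assms(1,3,4,8)]
  show ?thesis
    unfolding S_def using props by (auto simp: adjointable_def selfadjoint_def)
qed

end
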